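(* Let $\chi$ be a probability density on $\mathbb{R}^d$, let $f_0$ be a probability density on $\mathbb{R}^d$ (the true density), let $\Pi$ be a prior on $\mathscr{M}(\mathbb{R}^d\times\mathbb{R}^+)$, and let $\Pi^*$ be the prior induced by $\Pi$ on densities on $\mathbb{R}^d$ via the map $P\mapsto f_P$, $f_P(x)=\int \frac{1}{h^d}\chi\big(\frac{x-\theta}{h}\big)\,dP(\theta,h)$. Suppose: (B1) $\chi$ is bounded, continuous and positive everywhere; (B2) there exists $l_1>0$ such that $\chi(x)$ decreases as $x$ moves away from $0$ outside the ball $\{x:\|x\|<l_1\}$; (B3) there exists $l_2>0$ such that $\sum_{i=1}^d z_i\frac{\chi_i'(z)}{\chi(z)}<-1$ for $\|z\|\ge l_2$; (B4) for some $0<M<\infty$, $0<f_0(x)\le M$ for all $x$; (B5) $\left|\int f_0(x)\log f_0(x)\,dx\right|<\infty$; (B6) for some $\delta>0$, $\int f_0(x)\log\frac{f_0(x)}{\phi_\delta(x)}\,dx<\infty$, where $\phi_\delta(x)=\inf_{\|t-x\|<\delta}f_0(t)$; (B7) there exists $\eta>0$ such that $\left|\int f_0(x)\log\chi(2x\|x\|^\eta)\,dx\right|<\infty$, and $\int f_0(x)\left|\log\chi\big(\frac{x-a}{b}\big)\right|dx<\infty$ for any $a\in\mathbb{R}^d$, $b\in(0,\infty)$; (B8) the weak support of $\Pi$ is $\mathscr{M}(\mathbb{R}^d\times\mathbb{R}^+)$; (B9) when $d\ge2$, $\chi(y)=o(\|y\|^{-d})$ as $\|y\|\to\infty$. Then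 $f_0\in\mathrm{KL}(\Pi^* )$.
   Context: $\mathbb{R}^+=(0,\infty)$; $\|\cdot\|$ is the Euclidean norm; $\chi_i'(z)=\partial\chi(z)/\partial z_i$. $\mathscr{M}(S)$ is the set of probability measures on $S$; a prior is a probability measure on the indicated space. The weak support of a prior $\Pi$ on $\mathscr{M}(S)$ is its support in the topology of weak convergence, i.e. the set of $P$ all of whose weak neighborhoods have positive $\Pi$-probability. $f_0\in\mathrm{KL}(\Pi^* )$ means $\Pi^*(\{f:\int f_0\log(f_0/f)<\epsilon\})>0$ for every $\epsilon>0$. *)

theory Defs
  imports "HOL-Probability.Probability" "HOL-Library.Landau_Symbols"
begin

definition prob_densities :: "('a::euclidean_space \<Rightarrow> real) set" where
  "prob_densities =
     {f. f \<in> borel_measurable borel \<and> (\<forall>x. 0 \<le> f x) \<and> (\<integral>\<^sup>+x. ennreal (f x) \<partial>lborel) = 1}"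

text \<open>The probability measures on a subset \<open>S\<close> live on the trace Borel sigma-algebra of \<open>S\<close>,
  so their space is \<open>S\<close> itself and not the ambient type.\<close>

definition prob_measures :: "'a::topological_space set \<Rightarrow> 'a measure set" where
  "prob_measures S = space (prob_algebra (restrict_space borel S))"

definition priors :: "'a::topological_space set \<Rightarrow> 'a measure measure set" where
  "priors S = space (prob_algebra (prob_algebra (restrict_space borel S)))"

definition weak_topology :: "'a::topological_space set \<Rightarrow> 'a measure topology" where
  "weak_topology S = topology_generated_by
     {{P \<in> prob_measures S. (\<integral>s. g s \<partial>P) \<in> U} | (g :: 'a \<Rightarrow> real) U.
        continuous_on S g \<and> bounded (g ` S) \<and> open U}"

text \<open>For a separable metrizable \<open>S\<close> the Borel sigma-algebra of the weak topology is that of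
  \<^const>\<open>prob_algebra\<close>, so that every weakly open set below is measurable.\<close>

definition weak_support ::
    "'a::topological_space set \<Rightarrow> 'a measure measure \<Rightarrow> 'a measure set" where
  "weak_support S Q =
     {P \<in> prob_measures S. \<forall>U. openin (weak_topology S) U \<and> P \<in> U \<longrightarrow> 0 < emeasure Q U}"

definition loc_scale :: "((real ^ 'n::finite) \<times> real) set" where
  "loc_scale = UNIV \<times> {0<..}"

text \<open>The integral below may be infinite for \<open>x\<close> in a Lebesgue null set, where the Bochner
  integral gives the value 0; this only changes the version of the density.\<close>

definition mixture_density ::
    "(real ^ 'n::finite \<Rightarrow> real) \<Rightarrow> ((real ^ 'n) \<times> real) measure \<Rightarrow> real ^ 'n \<Rightarrow> real" where
  "mixture_density \<kappa> P x = integral\<^sup>L P (\<lambda>(\<theta>, h). 1 / h ^ CARD('n) * \<kappa> ((x - \<theta>) /\<^sub>R h))"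

text \<open>The push-forward of \<open>Q\<close>, on the largest sigma-algebra on densities for which
  \<^term>\<open>mixture_density \<kappa>\<close> is measurable: the induced prior of \<open>A\<close> is the \<open>Q\<close>-probability that
  the mixture density lies in \<open>A\<close>, whenever the latter event is measurable.\<close>

definition induced_prior ::
    "(real ^ 'n::finite \<Rightarrow> real) \<Rightarrow> ((real ^ 'n) \<times> real) measure measure
      \<Rightarrow> (real ^ 'n \<Rightarrow> real) measure" where
  "induced_prior \<kappa> Q =
     distr Q
       (sigma prob_densities
         {A. A \<subseteq> prob_densities \<and> mixture_density \<kappa> -` A \<inter> space Q \<in> sets Q})
       (mixture_density \<kappa>)"

definition ext_integral :: "'a measure \<Rightarrow> ('a \<Rightarrow> ereal) \<Rightarrow> ereal" where
  "ext_integral M F =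
     enn2ereal (\<integral>\<^sup>+x. e2ennreal (F x) \<partial>M) - enn2ereal (\<integral>\<^sup>+x. e2ennreal (- F x) \<partial>M)"

text \<open>The integral of \<open>f log (f / g)\<close> with the conventions \<open>0 log (0 / g) = 0\<close> and
  \<open>f log (f / 0) = \<infinity>\<close> for \<open>f > 0\<close>; note that \<^term>\<open>ln (y / 0 :: real) = 0\<close>.\<close>

definition log_ratio_integral ::
    "('a::euclidean_space \<Rightarrow> real) \<Rightarrow> ('a \<Rightarrow> real) \<Rightarrow> ereal" where
  "log_ratio_integral f g =
     ext_integral lborel
       (\<lambda>x. if f x = 0 then 0 else if g x = 0 then \<infinity> else ereal (f x * ln (f x / g x)))"

definition KL_support ::
    "('a::euclidean_space \<Rightarrow> real) measure \<Rightarrow> ('a \<Rightarrow> real) set" where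
  "KL_support Q =
     {f. \<forall>\<epsilon>>0. 0 < emeasure Q {g \<in> space Q. log_ratio_integral f g < ereal \<epsilon>}}"

definition local_inf ::
    "('a::euclidean_space \<Rightarrow> real) \<Rightarrow> real \<Rightarrow> 'a \<Rightarrow> real" where
  "local_inf f \<delta> x = (INF t\<in>ball x \<delta>. f t)"

definition has_partials :: "(real ^ 'n::finite \<Rightarrow> real) \<Rightarrow> real ^ 'n \<Rightarrow> bool" where
  "has_partials \<kappa> z \<longleftrightarrow> (\<forall>i. (\<lambda>t. \<kappa> (z + t *\<^sub>R axis i 1)) differentiable (at (0::real)))"

definition partial_deriv :: "'n::finite \<Rightarrow> (real ^ 'n \<Rightarrow> real) \<Rightarrow> real ^ 'n \<Rightarrow> real" where
  "partial_deriv i \<kappa> z = deriv (\<lambda>t. \<kappa> (z + t *\<^sub>R axis i 1)) 0"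

end

theory Submission
  imports Defs
begin

text \<open>
  Write \<open>k\<^sub>p\<close> for the kernel with parameter \<open>p = (\<theta>, h)\<close>, so that \<open>f\<^sub>P\<close> is the \<open>P\<close>-average of
  the \<open>k\<^sub>p\<close>. The full weak support gives positive prior mass to every nonempty weakly open set, so
  it is enough to find, for each \<open>\<epsilon> > 0\<close>, a nonempty weakly open set of \<open>P\<close> on which
  \<open>\<integral> f\<^sub>0 log (f\<^sub>0 / f\<^sub>P) < \<epsilon>\<close>. It is a neighbourhood of a finitely supported measure with two parts
  that control two different regions of the sample space.

  \<^emph>\<open>The bulk.\<close> A finite mixture \<open>s\<close> of kernels is close to \<open>f\<^sub>0\<close> in \<open>L\<^sup>1\<close>
  (\<open>finite_mixtures_L1_dense\<close>). By Scheffe's lemma \<open>k\<^sub>p\<close> depends on \<open>p\<close> continuously in \<open>L\<^sup>1\<close>, so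
  every \<open>P\<close> that puts nearly the weights of \<open>b s\<close>, with \<open>b\<close> slightly below \<open>1\<close>, into small disjoint
  balls around the atoms makes \<open>\<integral> max 0 (b f\<^sub>0 - f\<^sub>P)\<close> small (\<open>nn_integral_mixture_deficit_le\<close>).
  Where \<open>f\<^sub>P\<close> has a positive lower bound \<open>c'\<close> and \<open>f\<^sub>0 \<le> M\<close>, the inequality \<open>log y \<le> y - 1\<close> turns this
  into a bound for the logarithm:
  \<open>f\<^sub>0 log (f\<^sub>0 / f\<^sub>P) \<le> - f\<^sub>0 log b + (M / c') max 0 (b f\<^sub>0 - f\<^sub>P)\<close>.

  \<^emph>\<open>The tail.\<close> The remaining mass sits at one further atom \<open>p\<close>. It provides the lower bound \<open>c'\<close> on
  bounded sets, and it has to make \<open>\<integral> f\<^sub>0 log (1 / f\<^sub>P)\<close> small outside a large ball, where a nearby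
  \<open>P\<close> spreads the mass of the atom over a ball \<open>K\<close> of parameters. Jensen's inequality bounds
  \<open>- log f\<^sub>P\<close> by an average over \<open>q \<in> K\<close> of \<open>\<bar>log k\<^sub>q\<bar>\<close>, so what is needed is that the tail integrals
  \<open>\<integral> f\<^sub>0 \<bar>log k\<^sub>q\<bar>\<close> over \<open>\<parallel>x\<parallel> > R\<close> are small uniformly for \<open>q \<in> K\<close>. For each single \<open>q\<close> they tend to
  \<open>0\<close> by integrability; since they are lower semicontinuous in \<open>q\<close>, the Baire category theorem gives
  one ball \<open>K\<close> and one radius \<open>R\<close> that work uniformly (\<open>log_tail_uniformly_small\<close>). The atom \<open>p\<close> is
  chosen as the centre of that ball.

  Everything is estimated from above by extended nonnegative integrals, which makes all the
  exchanges of integration instances of Tonelli's theorem; \<open>log_ratio_integral_mixture_le\<close>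
  collects the estimates of both regions. That the event in question is measurable for the induced
  prior follows from joint measurability of \<open>(P, x) \<mapsto> f\<^sub>P(x)\<close>
  (\<open>KL_support_induced_priorI\<close>).
\<close>

section \<open>The L1 distance and continuous approximation\<close>

definition L1_dist :: "('a::euclidean_space \<Rightarrow> real) \<Rightarrow> ('a \<Rightarrow> real) \<Rightarrow> ennreal" where
  "L1_dist f g = (\<integral>\<^sup>+x. ennreal \<bar>f x - g x\<bar> \<partial>lborel)"

lemma L1_dist_commute: "L1_dist f g = L1_dist g f"
  by (simp add: L1_dist_def abs_minus_commute)

lemma L1_dist_triangle:
  assumes [measurable]: "f \<in> borel_measurable borel" "g \<in> borel_measurable borel" "k \<in> borel_measurable borel"
  shows "L1_dist f k \<le> L1_dist f g + L1_dist g k"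
proof -
  have "L1_dist f k \<le> (\<integral>\<^sup>+x. ennreal \<bar>f x - g x\<bar> + ennreal \<bar>g x - k x\<bar> \<partial>lborel)"
    unfolding L1_dist_def
    by (intro nn_integral_mono) (simp flip: ennreal_plus)
  also have "\<dots> = L1_dist f g + L1_dist g k"
    unfolding L1_dist_def by (intro nn_integral_add) auto
  finally show ?thesis .
qed

lemma L1_dist_scale:
  assumes [measurable]: "f \<in> borel_measurable borel" "g \<in> borel_measurable borel" and "0 \<le> c"
  shows "L1_dist (\<lambda>x. c * f x) (\<lambda>x. c * g x) = ennreal c * L1_dist f g"
  unfolding L1_dist_def using \<open>0 \<le> c\<close>
  by (subst nn_integral_cmult[symmetric])
     (auto intro!: nn_integral_cong simp: ennreal_mult[symmetric] abs_mult right_diff_distrib[symmetric])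

text \<open>Pointwise convergence of nonnegative functions becomes \<open>L\<^sup>1\<close> convergence once no mass can appear
  beyond that of the limit. All \<open>L\<^sup>1\<close> convergence of kernels and convolutions below comes from here:
  their masses are constant, so that only pointwise limits have to be computed.\<close>

lemma Scheffe_tendsto:
  fixes F :: "nat \<Rightarrow> 'a::euclidean_space \<Rightarrow> real"
  assumes [measurable]: "\<And>n. F n \<in> borel_measurable borel" "f \<in> borel_measurable borel"
    and nonneg: "\<And>n x. 0 \<le> F n x" "\<And>x. 0 \<le> f x"
    and lim: "\<And>x. (\<lambda>n. F n x) \<longlonglongrightarrow> f x"
    and mass: "\<And>n. (\<integral>\<^sup>+x. ennreal (F n x) \<partial>lborel) \<le> (\<integral>\<^sup>+x. ennreal (f x) \<partial>lborel)"
    and fin: "(\<integral>\<^sup>+x. ennreal (f x) \<partial>lborel) < \<infinity>"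
  shows "(\<lambda>n. L1_dist (F n) f) \<longlonglongrightarrow> 0"
proof -
  have "integrable lborel f"
    by (rule integrableI_nonneg) (use fin nonneg in auto)
  then have "(\<lambda>n. \<integral>\<^sup>+ x. norm (F n x - f x) \<partial>lborel) \<longlonglongrightarrow> 0"
    by (intro Scheffe_lemma2) (use nonneg lim mass in auto)
  then show ?thesis
    by (simp add: L1_dist_def)
qed

lemma nn_integral_lborel_affine:
  fixes f :: "'a::euclidean_space \<Rightarrow> ennreal"
  assumes [measurable]: "f \<in> borel_measurable borel" and "c \<noteq> 0"
  shows "(\<integral>\<^sup>+x. f x \<partial>lborel) = ennreal (\<bar>c\<bar> ^ DIM('a)) * (\<integral>\<^sup>+x. f (t + c *\<^sub>R x) \<partial>lborel)"
proof -
  have "(\<integral>\<^sup>+x. f x \<partial>lborel) = (\<integral>\<^sup>+x. f x \<partial>density (distr lborel borel (\<lambda>x. t + c *\<^sub>R x)) (\<lambda>_. \<bar>c\<bar>^DIM('a)))"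
    using lborel_affine[OF \<open>c \<noteq> 0\<close>, of t] by simp
  also have "\<dots> = (\<integral>\<^sup>+x. ennreal (\<bar>c\<bar> ^ DIM('a)) * f (t + c *\<^sub>R x) \<partial>lborel)"
    by (simp add: nn_integral_density nn_integral_distr)
  also have "\<dots> = ennreal (\<bar>c\<bar> ^ DIM('a)) * (\<integral>\<^sup>+x. f (t + c *\<^sub>R x) \<partial>lborel)"
    by (rule nn_integral_cmult) measurable
  finally show ?thesis .
qed

lemma L1_tail_small:
  fixes f :: "'a::euclidean_space \<Rightarrow> real"
  assumes [measurable]: "f \<in> borel_measurable borel"
    and "(\<integral>\<^sup>+x. ennreal \<bar>f x\<bar> \<partial>lborel) < \<infinity>" and "0 < e"
  shows "\<exists>R0. \<forall>R\<ge>R0. (\<integral>\<^sup>+x. ennreal \<bar>f x\<bar> * indicator (- cball 0 (real R)) x \<partial>lborel) \<le> ennreal e"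
proof -
  have "(\<lambda>n. \<integral>\<^sup>+x. ennreal \<bar>f x\<bar> * indicator (- cball 0 (real n)) x \<partial>lborel) \<longlonglongrightarrow> (\<integral>\<^sup>+x. 0 \<partial>(lborel::'a measure))"
  proof (rule nn_integral_dominated_convergence)
    show "AE x in lborel. (\<lambda>n. ennreal \<bar>f x\<bar> * indicator (- cball 0 (real n)) x) \<longlonglongrightarrow> 0"
    proof (rule AE_I2)
      fix x :: 'a
      obtain N where "norm x \<le> real N" using real_arch_simple by blast
      then have "ennreal \<bar>f x\<bar> * indicator (- cball 0 (real n)) x = 0" if "n \<ge> N" for n
        using that by (auto simp: indicator_def)
      then show "(\<lambda>n. ennreal \<bar>f x\<bar> * indicator (- cball 0 (real n)) x) \<longlonglongrightarrow> 0"
        by (intro tendsto_eventually eventually_sequentiallyI)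
    qed
    show "AE x in lborel. ennreal \<bar>f x\<bar> * indicator (- cball 0 (real n)) x \<le> ennreal \<bar>f x\<bar>" for n
      by (auto simp: indicator_def)
  qed (use assms in auto)
  then have "\<forall>\<^sub>F n in sequentially. (\<integral>\<^sup>+x. ennreal \<bar>f x\<bar> * indicator (- cball 0 (real n)) x \<partial>lborel) < ennreal e"
    by (rule order_tendstoD) (use \<open>0 < e\<close> in auto)
  then show ?thesis
    by (auto simp: eventually_sequentially intro: less_imp_le)
qed

text \<open>After cutting \<open>f\<close> off outside a ball, Lebesgue measurability provides continuous functions that
  converge to it almost everywhere. Clamping them to \<open>[0, M]\<close> and multiplying by a continuous cutoff
  keeps the limit and makes dominated convergence applicable.\<close>

lemma L1_dist_continuous_compact_support:
  fixes f :: "'a::euclidean_space \<Rightarrow> real"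
  assumes [measurable]: "f \<in> borel_measurable borel"
    and bd: "\<And>x. 0 \<le> f x" "\<And>x. f x \<le> M"
    and fin: "(\<integral>\<^sup>+x. ennreal (f x) \<partial>lborel) < \<infinity>" and "0 < e"
  shows "\<exists>g R. continuous_on UNIV g \<and> (\<forall>x. 0 \<le> g x \<and> g x \<le> M) \<and> (\<forall>x. x \<notin> cball 0 R \<longrightarrow> g x = 0)
           \<and> L1_dist f g \<le> ennreal e"
proof -
  have M: "0 \<le> M" using bd[of 0] by simp
  have [measurable]: "cball (0::'a) r \<in> sets borel" for r
    by simp
  obtain R :: nat where R: "(\<integral>\<^sup>+x. ennreal \<bar>f x\<bar> * indicator (- cball 0 R) x \<partial>lborel) \<le> ennreal (e / 2)"
    using L1_tail_small[of f "e/2"] assms by (auto simp: bd)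
  define k where "k x = f x * indicator (cball 0 R) x" for x
  have k_bd: "0 \<le> k x" "k x \<le> M" for x
    using bd M by (auto simp: k_def indicator_def)
  have [measurable]: "k \<in> borel_measurable borel"
    unfolding k_def by (intro borel_measurable_times borel_measurable_indicator assms(1)) simp
  have "L1_dist f k = (\<integral>\<^sup>+x. ennreal \<bar>f x\<bar> * indicator (- cball 0 R) x \<partial>lborel)"
    unfolding L1_dist_def by (intro nn_integral_cong) (auto simp: k_def indicator_def)
  with R have fk: "L1_dist f k \<le> ennreal (e / 2)" by simp
  have "k measurable_on UNIV"
    by (intro lebesgue_measurable_imp_measurable_on_nnreal_UNIV k_bd) (simp add: measurable_completion)
  then obtain N g where N: "negligible N" and g: "\<And>n. continuous_on UNIV (g n)"
      "\<And>x. x \<notin> N \<Longrightarrow> (\<lambda>n. g n x) \<longlonglongrightarrow> k x"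
    unfolding measurable_on_def by auto
  \<comment> \<open>clamped to \<open>[0, M]\<close> and cut off continuously between the radii \<open>R\<close> and \<open>R + 1\<close>\<close>
  define G where "G n x = min M (max 0 (g n x)) * max 0 (min 1 (real R + 1 - norm x))" for n x
  have G_cont: "continuous_on UNIV (G n)" for n
    unfolding G_def by (intro continuous_intros g)
  have [measurable]: "G n \<in> borel_measurable borel" for n
    using G_cont by (rule borel_measurable_continuous_onI)
  have G_bd: "0 \<le> G n x" "G n x \<le> M" for n x
    using M mult_mono[of "min M (max 0 (g n x))" M "max 0 (min 1 (real R + 1 - norm x))" 1]
    by (auto simp: G_def)
  have G_supp: "G n x = 0" if "x \<notin> cball 0 (real R + 1)" for n x
    using that by (simp add: G_def)
  have AE_N: "AE x in lborel. x \<notin> N"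
    using N by (metis AE_completion_iff AE_not_in negligible_iff_null_sets)
  have "(\<lambda>n. L1_dist (G n) k) \<longlonglongrightarrow> (\<integral>\<^sup>+x. 0 \<partial>(lborel::'a measure))"
    unfolding L1_dist_def
  proof (rule nn_integral_dominated_convergence)
    show "AE x in lborel. (\<lambda>n. ennreal \<bar>G n x - k x\<bar>) \<longlonglongrightarrow> 0"
      using AE_N
    proof eventually_elim
      fix x assume "x \<notin> N"
      then have "(\<lambda>n. G n x) \<longlonglongrightarrow> min M (max 0 (k x)) * max 0 (min 1 (real R + 1 - norm x))"
        unfolding G_def by (intro tendsto_intros g)
      also have "min M (max 0 (k x)) * max 0 (min 1 (real R + 1 - norm x)) = k x"
        using k_bd[of x] by (auto simp: k_def indicator_def)
      finally have "(\<lambda>n. \<bar>G n x - k x\<bar>) \<longlonglongrightarrow> \<bar>k x - k x\<bar>"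
        by (intro tendsto_intros)
      then show "(\<lambda>n. ennreal \<bar>G n x - k x\<bar>) \<longlonglongrightarrow> 0"
        using tendsto_ennrealI by fastforce
    qed
    show "AE x in lborel. ennreal \<bar>G n x - k x\<bar> \<le> ennreal M * indicator (cball 0 (real R + 1)) x" for n
    proof (rule AE_I2)
      fix x
      show "ennreal \<bar>G n x - k x\<bar> \<le> ennreal M * indicator (cball 0 (real R + 1)) x"
        using G_bd[of n x] k_bd[of x] G_supp[of x n]
        by (cases "x \<in> cball 0 (real R + 1)") (auto simp: k_def intro!: ennreal_leI)
    qed
    show "(\<integral>\<^sup>+x. ennreal M * indicator (cball 0 (real R + 1)) x \<partial>(lborel::'a measure)) < \<infinity>"
      using emeasure_compact_finite[of "cball (0::'a) (real R + 1)"]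
      by (subst nn_integral_cmult_indicator) (auto simp: ennreal_mult_less_top)
  qed auto
  then have "\<forall>\<^sub>F n in sequentially. L1_dist (G n) k < ennreal (e / 2)"
    by (rule order_tendstoD(2)) (use \<open>0 < e\<close> in auto)
  then obtain n where n: "L1_dist (G n) k < ennreal (e / 2)"
    by (auto simp: eventually_sequentially)
  have "L1_dist f (G n) \<le> L1_dist f k + L1_dist k (G n)"
    by (intro L1_dist_triangle) auto
  also have "\<dots> \<le> ennreal (e / 2) + ennreal (e / 2)"
    using n fk by (intro add_mono) (auto simp: L1_dist_commute[of k])
  finally have "L1_dist f (G n) \<le> ennreal e"
    using \<open>0 < e\<close> by (simp flip: ennreal_plus)
  with G_cont G_bd G_supp show ?thesis by blast
qed

text \<open>Used to assign to each location in a compact set one of finitely many nearby centres, in a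
  measurable way.\<close>

lemma disjoint_measurable_refinement:
  assumes "finite C" "\<And>c. c \<in> C \<Longrightarrow> U c \<in> sets M"
  shows "\<exists>B. (\<forall>c\<in>C. B c \<in> sets M \<and> B c \<subseteq> U c) \<and> disjoint_family_on B C \<and> (\<Union>c\<in>C. U c) \<subseteq> (\<Union>c\<in>C. B c)"
  using assms
proof (induction C)
  case empty
  then show ?case by (auto simp: disjoint_family_on_def)
next
  case (insert a C)
  then obtain B where B: "\<And>c. c \<in> C \<Longrightarrow> B c \<in> sets M" "\<And>c. c \<in> C \<Longrightarrow> B c \<subseteq> U c"
      "disjoint_family_on B C" "(\<Union>c\<in>C. U c) \<subseteq> (\<Union>c\<in>C. B c)"
    by auto
  define B' where "B' = B(a := U a - (\<Union>c\<in>C. B c))"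
  have eq: "B' c = B c" if "c \<in> C" for c
    using that insert by (auto simp: B'_def)
  have "B' c \<in> sets M \<and> B' c \<subseteq> U c" if "c \<in> insert a C" for c
    using that insert B(1,2) by (auto simp: B'_def)
  moreover have "disjoint_family_on B' (insert a C)"
    using B(3) insert(2) unfolding disjoint_family_on_def B'_def by auto
  moreover have "(\<Union>c\<in>insert a C. U c) \<subseteq> (\<Union>c\<in>insert a C. B' c)"
    using B(4) by (auto simp: eq) (auto simp: B'_def)
  ultimately show ?case by blast
qed

section \<open>Location-scale kernels\<close>

text \<open>The integrand of \<^const>\<open>mixture_density\<close>, with the parameter as a pair.\<close>

definition kern :: "(real ^ 'n::finite \<Rightarrow> real) \<Rightarrow> (real ^ 'n) \<times> real \<Rightarrow> real ^ 'n \<Rightarrow> real" where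
  "kern \<kappa> p x = 1 / snd p ^ CARD('n) * \<kappa> ((x - fst p) /\<^sub>R snd p)"

locale positive_kernel =
  fixes \<kappa> :: "real ^ 'n::finite \<Rightarrow> real"
  assumes density: "\<kappa> \<in> prob_densities"
    and cont: "continuous_on UNIV \<kappa>"
    and pos: "0 < \<kappa> x"
begin

lemma kappa_measurable [measurable]: "\<kappa> \<in> borel_measurable borel"
  using density by (simp add: prob_densities_def)

lemma kern_pos: "0 < snd p \<Longrightarrow> 0 < kern \<kappa> p x"
  by (simp add: kern_def pos)

lemma kern_measurable_pair [measurable]:
  "(\<lambda>z. kern \<kappa> (fst z) (snd z)) \<in> borel_measurable (borel \<Otimes>\<^sub>M borel)"
  unfolding kern_def borel_prod[symmetric] by measurable

lemma kern_measurable [measurable]: "kern \<kappa> p \<in> borel_measurable borel"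
  unfolding kern_def by measurable

lemma kern_measurable_param [measurable]: "(\<lambda>p. kern \<kappa> p x) \<in> borel_measurable borel"
  unfolding kern_def borel_prod[symmetric] by measurable

lemma kern_measurable_location [measurable]: "(\<lambda>\<theta>. kern \<kappa> (\<theta>, h) x) \<in> borel_measurable borel"
  unfolding kern_def fst_conv snd_conv by measurable

lemma kern_measurable_location_pair [measurable]:
  "(\<lambda>z. kern \<kappa> (fst z, h) (snd z)) \<in> borel_measurable (borel \<Otimes>\<^sub>M borel)"
  unfolding kern_def fst_conv snd_conv by measurable

lemma kern_tendsto:
  assumes "(f \<longlongrightarrow> p) F" "(g \<longlongrightarrow> x) F" "0 < snd p"
  shows "((\<lambda>n. kern \<kappa> (f n) (g n)) \<longlongrightarrow> kern \<kappa> p x) F"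
proof -
  have "isCont \<kappa> y" for y
    using cont by (simp add: continuous_on_eq_continuous_at)
  then show ?thesis
    unfolding kern_def using assms
    by (auto intro!: tendsto_intros isCont_tendsto_compose[where g=\<kappa>])
qed

lemma kern_continuous_on:
  "continuous_on (loc_scale \<times> UNIV) (\<lambda>z. kern \<kappa> (fst z) (snd z))"
  unfolding continuous_on_def
proof
  fix z :: "((real ^ 'n) \<times> real) \<times> (real ^ 'n)"
  assume "z \<in> loc_scale \<times> UNIV"
  then have "0 < snd (fst z)"
    by (auto simp: loc_scale_def)
  then show "((\<lambda>z. kern \<kappa> (fst z) (snd z)) \<longlongrightarrow> kern \<kappa> (fst z) (snd z)) (at z within loc_scale \<times> UNIV)"
    by (intro kern_tendsto tendsto_fst tendsto_snd tendsto_ident_at)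
qed

lemma nn_integral_kappa: "(\<integral>\<^sup>+x. ennreal (\<kappa> x) \<partial>lborel) = 1"
  using density by (simp add: prob_densities_def)

lemma nn_integral_kern:
  assumes "0 < snd p"
  shows "(\<integral>\<^sup>+x. ennreal (kern \<kappa> p x) \<partial>lborel) = 1"
proof -
  have "(\<integral>\<^sup>+x. ennreal (kern \<kappa> p x) \<partial>lborel)
      = ennreal (\<bar>snd p\<bar> ^ DIM(real^'n)) * (\<integral>\<^sup>+x. ennreal (kern \<kappa> p (fst p + snd p *\<^sub>R x)) \<partial>lborel)"
    using assms by (intro nn_integral_lborel_affine) auto
  also have "\<dots> = (\<integral>\<^sup>+x. ennreal (\<bar>snd p\<bar> ^ DIM(real^'n)) * ennreal (kern \<kappa> p (fst p + snd p *\<^sub>R x)) \<partial>lborel)"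
    by (rule nn_integral_cmult[symmetric]) measurable
  also have "\<dots> = (\<integral>\<^sup>+x. ennreal (\<kappa> x) \<partial>lborel)"
    using assms pos less_imp_le[OF pos]
    by (intro nn_integral_cong) (simp add: kern_def ennreal_mult[symmetric])
  finally show ?thesis by (simp add: nn_integral_kappa)
qed

text \<open>The kernel is continuous in the parameter for each fixed \<open>x\<close>, and all kernels have mass one; so
  Scheffe's lemma upgrades pointwise continuity to continuity in \<open>L\<^sup>1\<close>.\<close>

lemma kern_L1_continuous:
  assumes "0 < snd p" "0 < e"
  shows "\<exists>r>0. \<forall>q. dist q p < r \<longrightarrow> 0 < snd q \<and> L1_dist (kern \<kappa> q) (kern \<kappa> p) \<le> ennreal e"
proof -
  have "\<forall>\<^sub>F q in nhds p. 0 < snd q \<and> L1_dist (kern \<kappa> q) (kern \<kappa> p) < ennreal e"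
  proof (rule sequentially_imp_eventually_nhds_within[where s=UNIV, simplified], intro allI impI)
    fix q assume q: "q \<longlonglongrightarrow> p"
    then have ev: "\<forall>\<^sub>F n in sequentially. 0 < snd (q n)"
      using assms(1) tendsto_snd order_tendstoD(1) by blast
    then obtain N where N: "\<And>n. n \<ge> N \<Longrightarrow> 0 < snd (q n)"
      by (auto simp: eventually_sequentially)
    have "(\<lambda>n. L1_dist (kern \<kappa> (q (n + N))) (kern \<kappa> p)) \<longlonglongrightarrow> 0"
    proof (rule Scheffe_tendsto)
      show "(\<lambda>n. kern \<kappa> (q (n + N)) x) \<longlonglongrightarrow> kern \<kappa> p x" for x
        using assms(1) by (intro kern_tendsto tendsto_const LIMSEQ_ignore_initial_segment q)
      show "0 \<le> kern \<kappa> (q (n + N)) x" for n x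
        using N[of "n + N"] by (intro less_imp_le kern_pos) auto
    qed (use assms N in \<open>auto simp: nn_integral_kern intro: less_imp_le kern_pos\<close>)
    then have "(\<lambda>n. L1_dist (kern \<kappa> (q n)) (kern \<kappa> p)) \<longlonglongrightarrow> 0"
      by (rule LIMSEQ_offset)
    then have "\<forall>\<^sub>F n in sequentially. L1_dist (kern \<kappa> (q n)) (kern \<kappa> p) < ennreal e"
      by (rule order_tendstoD) (use assms(2) in auto)
    with ev show "\<forall>\<^sub>F n in sequentially. 0 < snd (q n) \<and> L1_dist (kern \<kappa> (q n)) (kern \<kappa> p) < ennreal e"
      by eventually_elim auto
  qed
  then show ?thesis
    unfolding eventually_nhds_metric by (auto intro: less_imp_le)
qed

end

section \<open>Finite mixtures are dense in L1\<close>

context positive_kernel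
begin

text \<open>The substitution \<open>\<theta> = x - h z\<close> writes the mixture with fixed scale \<open>h\<close> as
  \<open>\<integral> \<kappa> z * g (x - h * z) dz\<close>, which tends to \<open>g x\<close> as \<open>h\<close> tends to \<open>0\<close> because \<open>g\<close> is bounded and
  continuous. Convolution with a density preserves mass, hence the convergence is in \<open>L\<^sup>1\<close>.\<close>

lemma kern_convolution_L1_approx:
  assumes g: "continuous_on UNIV g" "\<And>x. 0 \<le> g x" "\<And>x. g x \<le> M"
    and fin: "(\<integral>\<^sup>+x. ennreal (g x) \<partial>lborel) < \<infinity>" and "0 < e"
  shows "\<exists>h>0. L1_dist (\<lambda>x. \<integral>\<theta>. g \<theta> * kern \<kappa> (\<theta>, h) x \<partial>lborel) g \<le> ennreal e
           \<and> (\<forall>x. integrable lborel (\<lambda>\<theta>. g \<theta> * kern \<kappa> (\<theta>, h) x))"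
proof -
  have [measurable]: "g \<in> borel_measurable borel"
    using g(1) by (rule borel_measurable_continuous_onI)
  have kappa_int: "integrable lborel \<kappa>"
    by (rule integrableI_nonneg) (auto simp: nn_integral_kappa less_imp_le[OF pos])
  have kappa_integral: "(\<integral>z. \<kappa> z \<partial>lborel) = 1"
    by (subst integral_eq_nn_integral) (auto simp: nn_integral_kappa less_imp_le[OF pos])
  define h where "h n = 1 / real (Suc n)" for n
  have h_pos: "0 < h n" for n by (simp add: h_def)
  define U where "U n x = (\<integral>z. \<kappa> z * g (x - h n *\<^sub>R z) \<partial>lborel)" for n x
  have dom: "\<bar>\<kappa> z * g y\<bar> \<le> M * \<kappa> z" for z y
    using g(2,3)[of y] pos[of z] by (simp add: abs_mult mult.commute mult_right_mono)
  have U_int: "integrable lborel (\<lambda>z. \<kappa> z * g (x - h n *\<^sub>R z))" for n x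
    by (rule Bochner_Integration.integrable_bound[where f="\<lambda>z. M * \<kappa> z"])
       (use kappa_int dom in \<open>auto intro: order_trans[OF _ abs_ge_self]\<close>)
  have [measurable]: "U n \<in> borel_measurable borel" for n
    unfolding U_def by measurable
  have U_enn: "ennreal (U n x) = (\<integral>\<^sup>+z. ennreal (\<kappa> z * g (x - h n *\<^sub>R z)) \<partial>lborel)" for n x
    unfolding U_def using U_int
    by (intro nn_integral_eq_integral[symmetric]) (auto simp: g(2) less_imp_le[OF pos])
  have conv: "(\<integral>\<^sup>+\<theta>. ennreal (g \<theta> * kern \<kappa> (\<theta>, h n) x) \<partial>lborel) = ennreal (U n x)" for n x
  proof -
    have "(\<integral>\<^sup>+\<theta>. ennreal (g \<theta> * kern \<kappa> (\<theta>, h n) x) \<partial>lborel)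
        = ennreal (\<bar>- h n\<bar> ^ DIM(real^'n)) *
            (\<integral>\<^sup>+z. ennreal (g (x + (- h n) *\<^sub>R z) * kern \<kappa> (x + (- h n) *\<^sub>R z, h n) x) \<partial>lborel)"
      using h_pos[of n] by (intro nn_integral_lborel_affine) (simp_all, measurable)
    also have "\<dots> = (\<integral>\<^sup>+z. ennreal (\<bar>- h n\<bar> ^ DIM(real^'n)) *
            ennreal (g (x + (- h n) *\<^sub>R z) * kern \<kappa> (x + (- h n) *\<^sub>R z, h n) x) \<partial>lborel)"
      by (rule nn_integral_cmult[symmetric]) measurable
    also have "\<dots> = (\<integral>\<^sup>+z. ennreal (\<kappa> z * g (x - h n *\<^sub>R z)) \<partial>lborel)"
      using h_pos[of n] g(2) less_imp_le[OF pos]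
      by (intro nn_integral_cong) (simp add: kern_def ennreal_mult[symmetric])
    finally show ?thesis by (simp add: U_enn)
  qed
  have int: "integrable lborel (\<lambda>\<theta>. g \<theta> * kern \<kappa> (\<theta>, h n) x)" for n x
  proof (rule integrableI_nonneg)
    show "(\<lambda>\<theta>. g \<theta> * kern \<kappa> (\<theta>, h n) x) \<in> borel_measurable lborel"
      by measurable
    show "AE \<theta> in lborel. 0 \<le> g \<theta> * kern \<kappa> (\<theta>, h n) x"
      using g(2) h_pos by (intro AE_I2 mult_nonneg_nonneg less_imp_le[OF kern_pos]) auto
  qed (simp add: conv)
  have U_eq: "(\<integral>\<theta>. g \<theta> * kern \<kappa> (\<theta>, h n) x \<partial>lborel) = U n x" for n x
  proof -
    have "0 \<le> U n x"
      unfolding U_def by (intro integral_nonneg_AE AE_I2 mult_nonneg_nonneg g less_imp_le[OF pos])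
    moreover have "(\<integral>\<theta>. g \<theta> * kern \<kappa> (\<theta>, h n) x \<partial>lborel) = enn2real (\<integral>\<^sup>+\<theta>. ennreal (g \<theta> * kern \<kappa> (\<theta>, h n) x) \<partial>lborel)"
      using g(2) h_pos int[of n x]
      by (intro integral_eq_nn_integral AE_I2 mult_nonneg_nonneg less_imp_le[OF kern_pos]) auto
    ultimately show ?thesis by (simp add: conv)
  qed
  have "(\<lambda>n. L1_dist (U n) g) \<longlonglongrightarrow> 0"
  proof (rule Scheffe_tendsto)
    show "0 \<le> U n x" for n x
      unfolding U_def by (intro integral_nonneg_AE AE_I2 mult_nonneg_nonneg g less_imp_le[OF pos])
    show "(\<lambda>n. U n x) \<longlonglongrightarrow> g x" for x
    proof -
      have "(\<lambda>n. U n x) \<longlonglongrightarrow> (\<integral>z. \<kappa> z * g x \<partial>lborel)"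
        unfolding U_def
      proof (rule integral_dominated_convergence[where w="\<lambda>z. M * \<kappa> z"])
        have "isCont g x" using g(1) by (simp add: continuous_on_eq_continuous_at)
        have "(\<lambda>n. \<kappa> z * g (x - h n *\<^sub>R z)) \<longlonglongrightarrow> \<kappa> z * g x" for z
        proof -
          have "h \<longlonglongrightarrow> 0"
            unfolding h_def using LIMSEQ_inverse_real_of_nat by (simp add: inverse_eq_divide)
          then have "(\<lambda>n. x - h n *\<^sub>R z) \<longlonglongrightarrow> x - 0 *\<^sub>R z"
            by (intro tendsto_intros)
          then show ?thesis
            using \<open>isCont g x\<close> by (intro tendsto_intros isCont_tendsto_compose[where g=g]) auto
        qed
        then show "AE z in lborel. (\<lambda>n. \<kappa> z * g (x - h n *\<^sub>R z)) \<longlonglongrightarrow> \<kappa> z * g x"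
          by simp
      qed (use kappa_int dom in auto)
      then show ?thesis by (simp add: kappa_integral)
    qed
    show "(\<integral>\<^sup>+x. ennreal (U n x) \<partial>lborel) \<le> (\<integral>\<^sup>+x. ennreal (g x) \<partial>lborel)" for n
    proof -
      have "(\<integral>\<^sup>+x. ennreal (U n x) \<partial>lborel)
          = (\<integral>\<^sup>+z. \<integral>\<^sup>+x. ennreal (\<kappa> z * g (x - h n *\<^sub>R z)) \<partial>lborel \<partial>lborel)"
        unfolding U_enn by (rule lborel_pair.Fubini') measurable
      also have "\<dots> = (\<integral>\<^sup>+z. ennreal (\<kappa> z) * (\<integral>\<^sup>+x. ennreal (g x) \<partial>lborel) \<partial>lborel)"
      proof (intro nn_integral_cong)
        fix z
        have "(\<integral>\<^sup>+x. ennreal (\<kappa> z * g (x - h n *\<^sub>R z)) \<partial>lborel)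
            = (\<integral>\<^sup>+x. ennreal (\<kappa> z) * ennreal (g (- (h n *\<^sub>R z) + 1 *\<^sub>R x)) \<partial>lborel)"
          by (intro nn_integral_cong) (simp add: ennreal_mult g(2) less_imp_le[OF pos])
        also have "\<dots> = ennreal (\<kappa> z) * (\<integral>\<^sup>+x. ennreal (g (- (h n *\<^sub>R z) + 1 *\<^sub>R x)) \<partial>lborel)"
          by (rule nn_integral_cmult) measurable
        also have "(\<integral>\<^sup>+x. ennreal (g (- (h n *\<^sub>R z) + 1 *\<^sub>R x)) \<partial>lborel) = (\<integral>\<^sup>+x. ennreal (g x) \<partial>lborel)"
          using nn_integral_lborel_affine[of "\<lambda>x. ennreal (g x)" 1 "- (h n *\<^sub>R z)"] by simp
        finally show "(\<integral>\<^sup>+x. ennreal (\<kappa> z * g (x - h n *\<^sub>R z)) \<partial>lborel) = ennreal (\<kappa> z) * (\<integral>\<^sup>+x. ennreal (g x) \<partial>lborel)" .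
      qed
      also have "\<dots> = (\<integral>\<^sup>+x. ennreal (g x) \<partial>lborel)"
        by (subst nn_integral_multc) (auto simp: nn_integral_kappa)
      finally show ?thesis by simp
    qed
  qed (use g fin in auto)
  then have "\<forall>\<^sub>F n in sequentially. L1_dist (U n) g < ennreal e"
    by (rule order_tendstoD(2)) (use \<open>0 < e\<close> in auto)
  then obtain n where n: "L1_dist (U n) g < ennreal e"
    by (auto simp: eventually_sequentially)
  with int h_pos[of n] show ?thesis
    by (intro exI[of _ "h n"]) (simp add: U_eq less_imp_le)
qed

text \<open>A Riemann sum: the compact support of \<open>g\<close> is divided into finitely many pieces such that the
  kernels located in one piece are \<open>e\<close>-close in \<open>L\<^sup>1\<close>, and the \<open>g\<close>-mass of each piece is moved to
  its centre. By Tonelli the resulting error is at most \<open>e\<close> times the total mass of \<open>g\<close>.\<close>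

lemma finite_mixture_L1_approx_convolution:
  assumes [measurable]: "g \<in> borel_measurable borel" and g: "\<And>x. 0 \<le> g x" "\<And>x. x \<notin> cball 0 R \<Longrightarrow> g x = 0"
    and fin: "(\<integral>\<^sup>+x. ennreal (g x) \<partial>lborel) < \<infinity>" and "0 < h" "0 < e"
    and int: "\<And>x. integrable lborel (\<lambda>\<theta>. g \<theta> * kern \<kappa> (\<theta>, h) x)"
  shows "\<exists>C w. finite C \<and> (\<forall>c\<in>C. 0 \<le> w c) \<and>
           L1_dist (\<lambda>x. \<Sum>c\<in>C. w c * kern \<kappa> (c, h) x) (\<lambda>x. \<integral>\<theta>. g \<theta> * kern \<kappa> (\<theta>, h) x \<partial>lborel)
             \<le> ennreal e * (\<integral>\<^sup>+x. ennreal (g x) \<partial>lborel)"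
proof -
  have "\<forall>c. \<exists>r>0. \<forall>q. dist q (c, h) < r \<longrightarrow> L1_dist (kern \<kappa> q) (kern \<kappa> (c, h)) \<le> ennreal e"
    using kern_L1_continuous[of "(_, h)" e] \<open>0 < h\<close> \<open>0 < e\<close> by (metis snd_conv)
  then obtain r where r: "\<And>c. 0 < r c"
      "\<And>c q. dist q (c, h) < r c \<Longrightarrow> L1_dist (kern \<kappa> q) (kern \<kappa> (c, h)) \<le> ennreal e"
    by metis
  obtain C where C: "finite C" "cball 0 R \<subseteq> (\<Union>c\<in>C. ball c (r c))"
    using compactE_image[of "cball 0 R" "cball 0 R" "\<lambda>c. ball c (r c)"] r(1)
    by (metis (no_types, lifting) UN_iff centre_in_ball compact_cball open_ball subsetI)
  obtain B where B: "\<And>c. c \<in> C \<Longrightarrow> B c \<in> sets borel" "\<And>c. c \<in> C \<Longrightarrow> B c \<subseteq> ball c (r c)"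
      "disjoint_family_on B C" "(\<Union>c\<in>C. ball c (r c)) \<subseteq> (\<Union>c\<in>C. B c)"
    using disjoint_measurable_refinement[OF C(1), of "\<lambda>c. ball c (r c)" borel] by auto
  define w where "w c = (\<integral>\<theta>. g \<theta> * indicator (B c) \<theta> \<partial>lborel)" for c
  \<comment> \<open>the kernel at the centre of the piece that contains \<open>\<theta>\<close>\<close>
  define m where "m \<theta> x = (\<Sum>c\<in>C. indicator (B c) \<theta> * kern \<kappa> (c, h) x)" for \<theta> x
  have g_int: "integrable lborel g"
    by (rule integrableI_nonneg) (use fin g in auto)
  have gB_int: "integrable lborel (\<lambda>\<theta>. g \<theta> * indicator (B c) \<theta>)" if "c \<in> C" for c
    using integrable_real_mult_indicator[OF _ g_int, of "B c"] B(1)[OF that] by simp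
  have gm: "g \<theta> * m \<theta> x = (\<Sum>c\<in>C. g \<theta> * indicator (B c) \<theta> * kern \<kappa> (c, h) x)" for \<theta> x
    by (simp add: m_def sum_distrib_left mult_ac)
  have gm_int: "integrable lborel (\<lambda>\<theta>. g \<theta> * m \<theta> x)" for x
    unfolding gm using gB_int by (intro Bochner_Integration.integrable_sum integrable_mult_left)
  have s_eq: "(\<Sum>c\<in>C. w c * kern \<kappa> (c, h) x) = (\<integral>\<theta>. g \<theta> * m \<theta> x \<partial>lborel)" for x
    unfolding gm w_def using gB_int by (subst Bochner_Integration.integral_sum) auto
  have [measurable]: "(\<lambda>(\<theta>, x). g \<theta> * (m \<theta> x - kern \<kappa> (\<theta>, h) x)) \<in> borel_measurable (borel \<Otimes>\<^sub>M borel)"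
    unfolding m_def using B(1) by measurable
  have "L1_dist (\<lambda>x. \<Sum>c\<in>C. w c * kern \<kappa> (c, h) x) (\<lambda>x. \<integral>\<theta>. g \<theta> * kern \<kappa> (\<theta>, h) x \<partial>lborel)
      \<le> (\<integral>\<^sup>+x. \<integral>\<^sup>+\<theta>. ennreal \<bar>g \<theta> * (m \<theta> x - kern \<kappa> (\<theta>, h) x)\<bar> \<partial>lborel \<partial>lborel)"
    unfolding L1_dist_def
  proof (rule nn_integral_mono)
    fix x
    have "(\<Sum>c\<in>C. w c * kern \<kappa> (c, h) x) - (\<integral>\<theta>. g \<theta> * kern \<kappa> (\<theta>, h) x \<partial>lborel)
        = (\<integral>\<theta>. g \<theta> * (m \<theta> x - kern \<kappa> (\<theta>, h) x) \<partial>lborel)"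
      unfolding s_eq right_diff_distrib
      by (rule Bochner_Integration.integral_diff[OF gm_int int, symmetric])
    moreover have "integrable lborel (\<lambda>\<theta>. g \<theta> * (m \<theta> x - kern \<kappa> (\<theta>, h) x))"
      unfolding right_diff_distrib by (intro Bochner_Integration.integrable_diff gm_int int)
    ultimately show "ennreal \<bar>(\<Sum>c\<in>C. w c * kern \<kappa> (c, h) x) - (\<integral>\<theta>. g \<theta> * kern \<kappa> (\<theta>, h) x \<partial>lborel)\<bar>
        \<le> (\<integral>\<^sup>+\<theta>. ennreal \<bar>g \<theta> * (m \<theta> x - kern \<kappa> (\<theta>, h) x)\<bar> \<partial>lborel)"
      using integral_norm_bound_ennreal by fastforce
  qed
  also have "\<dots> = (\<integral>\<^sup>+\<theta>. \<integral>\<^sup>+x. ennreal \<bar>g \<theta> * (m \<theta> x - kern \<kappa> (\<theta>, h) x)\<bar> \<partial>lborel \<partial>lborel)"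
    by (rule lborel_pair.Fubini') measurable
  also have "\<dots> \<le> (\<integral>\<^sup>+\<theta>. ennreal e * ennreal (g \<theta>) \<partial>lborel)"
  proof (rule nn_integral_mono)
    fix \<theta>
    have [measurable]: "m \<theta> \<in> borel_measurable borel"
      unfolding m_def by measurable
    have "(\<integral>\<^sup>+x. ennreal \<bar>g \<theta> * (m \<theta> x - kern \<kappa> (\<theta>, h) x)\<bar> \<partial>lborel) = ennreal (g \<theta>) * L1_dist (m \<theta>) (kern \<kappa> (\<theta>, h))"
      unfolding L1_dist_def by (subst nn_integral_cmult[symmetric]) (auto simp: abs_mult ennreal_mult g)
    also have "\<dots> \<le> ennreal (g \<theta>) * ennreal e"
    proof (cases "\<theta> \<in> cball 0 R")
      case True
      then obtain c where c: "c \<in> C" "\<theta> \<in> B c" using C B(4) by blast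
      have "indicat_real (B d) \<theta> = (if d = c then 1 else 0)" if "d \<in> C" for d
        using c that B(3) by (auto simp: disjoint_family_on_def indicator_def)
      then have "m \<theta> = kern \<kappa> (c, h)"
        unfolding m_def using c C(1) by (simp add: if_distrib[of "\<lambda>t. t * _"] cong: if_cong)
      moreover have "dist (\<theta>, h) (c, h) < r c"
        using B(2)[OF c(1)] c(2) by (auto simp: dist_Pair_Pair dist_commute)
      ultimately show ?thesis
        using r(2)[of "(\<theta>, h)" c] by (auto simp: L1_dist_commute intro!: mult_left_mono)
    next
      case False
      then show ?thesis by (simp add: g(2))
    qed
    finally show "(\<integral>\<^sup>+x. ennreal \<bar>g \<theta> * (m \<theta> x - kern \<kappa> (\<theta>, h) x)\<bar> \<partial>lborel) \<le> ennreal e * ennreal (g \<theta>)"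
      by (simp add: mult.commute)
  qed
  also have "\<dots> = ennreal e * (\<integral>\<^sup>+x. ennreal (g x) \<partial>lborel)"
    by (rule nn_integral_cmult) measurable
  finally have "L1_dist (\<lambda>x. \<Sum>c\<in>C. w c * kern \<kappa> (c, h) x) (\<lambda>x. \<integral>\<theta>. g \<theta> * kern \<kappa> (\<theta>, h) x \<partial>lborel)
      \<le> ennreal e * (\<integral>\<^sup>+x. ennreal (g x) \<partial>lborel)" .
  moreover have "\<forall>c\<in>C. 0 \<le> w c"
    unfolding w_def by (auto intro!: integral_nonneg_AE mult_nonneg_nonneg g)
  ultimately show ?thesis using C(1) by blast
qed

theorem finite_mixtures_L1_dense:
  assumes [measurable]: "f \<in> borel_measurable borel"
    and bd: "\<And>x. 0 \<le> f x" "\<And>x. f x \<le> M"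
    and fin: "(\<integral>\<^sup>+x. ennreal (f x) \<partial>lborel) < \<infinity>" and "0 < e"
  shows "\<exists>A w. finite A \<and> A \<subseteq> loc_scale \<and> (\<forall>p\<in>A. 0 \<le> w p) \<and>
           L1_dist (\<lambda>x. \<Sum>p\<in>A. w p * kern \<kappa> p x) f \<le> ennreal e"
proof -
  obtain g R where g: "continuous_on UNIV g" "\<And>x. 0 \<le> g x" "\<And>x. g x \<le> M" "\<And>x. x \<notin> cball 0 R \<Longrightarrow> g x = 0"
      "L1_dist f g \<le> ennreal (e / 3)"
    using L1_dist_continuous_compact_support[OF assms(1) bd fin, of "e / 3"] \<open>0 < e\<close> by auto
  have [measurable]: "g \<in> borel_measurable borel"
    using g(1) by (rule borel_measurable_continuous_onI)
  have "(\<integral>\<^sup>+x. ennreal (g x) \<partial>lborel) \<le> (\<integral>\<^sup>+x. ennreal M * indicator (cball (0::real^'n) R) x \<partial>lborel)"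
    using g(3,4) by (intro nn_integral_mono) (auto simp: indicator_def intro!: ennreal_leI)
  also have "\<dots> < \<infinity>"
    using emeasure_compact_finite[of "cball (0::real^'n) R"]
    by (subst nn_integral_cmult_indicator) (auto simp: ennreal_mult_less_top)
  finally have gfin: "(\<integral>\<^sup>+x. ennreal (g x) \<partial>lborel) < \<infinity>" .
  then obtain I where I: "0 \<le> I" "(\<integral>\<^sup>+x. ennreal (g x) \<partial>lborel) = ennreal I"
    by (metis ennreal_cases infinity_ennreal_def less_irrefl)
  define T where "T h x = (\<integral>\<theta>. g \<theta> * kern \<kappa> (\<theta>, h) x \<partial>lborel)" for h x
  obtain h where h: "0 < h" "L1_dist (T h) g \<le> ennreal (e / 3)" "\<And>x. integrable lborel (\<lambda>\<theta>. g \<theta> * kern \<kappa> (\<theta>, h) x)"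
    using kern_convolution_L1_approx[OF g(1-3) gfin, of "e / 3"] \<open>0 < e\<close> unfolding T_def by auto
  \<comment> \<open>dividing by \<open>I + 1\<close> compensates the factor \<open>I\<close> of the Riemann sum error, also when \<open>I = 0\<close>\<close>
  obtain C w where C: "finite C" "\<And>c. c \<in> C \<Longrightarrow> 0 \<le> w c"
      "L1_dist (\<lambda>x. \<Sum>c\<in>C. w c * kern \<kappa> (c, h) x) (T h) \<le> ennreal (e / 3 / (I + 1)) * ennreal I"
    using finite_mixture_L1_approx_convolution[OF _ g(2,4) gfin h(1) _ h(3), where R = R and e = "e / 3 / (I + 1)"] \<open>0 < e\<close> I
    unfolding T_def by auto
  have [measurable]: "T h \<in> borel_measurable borel"
  proof -
    have "(\<lambda>(x, \<theta>). g \<theta> * kern \<kappa> (\<theta>, h) x) \<in> borel_measurable (borel \<Otimes>\<^sub>M lborel)"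
      unfolding kern_def fst_conv snd_conv by measurable
    then show ?thesis
      unfolding T_def by (rule lborel.borel_measurable_lebesgue_integral)
  qed
  have "e / 3 / (I + 1) * I \<le> e / 3"
    using I \<open>0 < e\<close> by (simp add: field_simps)
  then have C3: "L1_dist (\<lambda>x. \<Sum>c\<in>C. w c * kern \<kappa> (c, h) x) (T h) \<le> ennreal (e / 3)"
    using C(3) I(1) \<open>0 < e\<close> by (auto simp: ennreal_mult[symmetric] intro: order_trans ennreal_leI)
  let ?s = "\<lambda>x. \<Sum>c\<in>C. w c * kern \<kappa> (c, h) x"
  have "L1_dist ?s f \<le> L1_dist ?s (T h) + L1_dist (T h) f"
    by (intro L1_dist_triangle) measurable
  also have "\<dots> \<le> L1_dist ?s (T h) + (L1_dist (T h) g + L1_dist g f)"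
    by (intro add_left_mono L1_dist_triangle) measurable
  also have "\<dots> \<le> ennreal (e / 3) + (ennreal (e / 3) + ennreal (e / 3))"
    using C3 h(2) g(5) by (intro add_mono) (auto simp: L1_dist_commute[of g f])
  also have "\<dots> = ennreal e"
    using \<open>0 < e\<close> by (simp flip: ennreal_plus)
  finally have "L1_dist ?s f \<le> ennreal e" .
  moreover have "(\<Sum>p\<in>(\<lambda>c. (c, h)) ` C. w (fst p) * kern \<kappa> p x) = ?s x" for x
    by (subst sum.reindex) (auto simp: inj_on_def)
  ultimately show ?thesis
    using C(1,2) h(1) by (intro exI[of _ "(\<lambda>c. (c, h)) ` C"] exI[of _ "\<lambda>p. w (fst p)"]) (auto simp: loc_scale_def)
qed

end

section \<open>Uniformly small logarithmic tails\<close>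

text \<open>The Baire category theorem for a countable closed cover.\<close>

lemma closed_union_UNIV_has_interior:
  fixes E :: "nat \<Rightarrow> 'a::{real_normed_vector,heine_borel} set"
  assumes "\<And>n. closed (E n)" "(\<Union>n. E n) = UNIV"
  shows "\<exists>n. interior (E n) \<noteq> {}"
proof (rule ccontr)
  assume "\<not> (\<exists>n. interior (E n) \<noteq> {})"
  then have "closure (- E n) = UNIV" for n
    by (simp add: closure_complement)
  then have "UNIV \<subseteq> closure (\<Inter>(range (\<lambda>n. - E n)))"
    by (intro Baire) (auto simp: assms(1) open_Compl)
  moreover have "(\<Inter>(range (\<lambda>n. - E n))) = {}"
    using assms(2) by blast
  ultimately show False
    by simp
qed

context positive_kernel
begin

lemma log_kern_integrable:
  assumes "integrable lborel f" "\<And>x. 0 \<le> f x" "0 < snd q"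
    and "integrable lborel (\<lambda>x. f x * \<bar>ln (\<kappa> ((x - fst q) /\<^sub>R snd q))\<bar>)"
  shows "integrable lborel (\<lambda>x. f x * \<bar>ln (kern \<kappa> q x)\<bar>)"
proof (rule Bochner_Integration.integrable_bound)
  let ?c = "\<bar>ln (1 / snd q ^ CARD('n))\<bar>"
  show "integrable lborel (\<lambda>x. ?c * f x + f x * \<bar>ln (\<kappa> ((x - fst q) /\<^sub>R snd q))\<bar>)"
    using assms by auto
  have [measurable]: "f \<in> borel_measurable lborel"
    using assms(1) by auto
  show "(\<lambda>x. f x * \<bar>ln (kern \<kappa> q x)\<bar>) \<in> borel_measurable lborel"
    by measurable
  show "AE x in lborel. norm (f x * \<bar>ln (kern \<kappa> q x)\<bar>)
          \<le> norm (?c * f x + f x * \<bar>ln (\<kappa> ((x - fst q) /\<^sub>R snd q))\<bar>)"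
  proof (rule AE_I2)
    fix x
    have "ln (kern \<kappa> q x) = ln (1 / snd q ^ CARD('n)) + ln (\<kappa> ((x - fst q) /\<^sub>R snd q))"
      unfolding kern_def using assms(3) pos by (intro ln_mult_pos) auto
    then have "f x * \<bar>ln (kern \<kappa> q x)\<bar> \<le> f x * (?c + \<bar>ln (\<kappa> ((x - fst q) /\<^sub>R snd q))\<bar>)"
      by (intro mult_left_mono assms(2)) simp
    then show "norm (f x * \<bar>ln (kern \<kappa> q x)\<bar>) \<le> norm (?c * f x + f x * \<bar>ln (\<kappa> ((x - fst q) /\<^sub>R snd q))\<bar>)"
      using assms(2)[of x] by (simp add: algebra_simps abs_mult)
  qed
qed

definition log_tail :: "(real ^ 'n \<Rightarrow> real) \<Rightarrow> nat \<Rightarrow> (real ^ 'n) \<times> real \<Rightarrow> ennreal" where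
  "log_tail f R q = (\<integral>\<^sup>+x. ennreal (f x * \<bar>ln (kern \<kappa> q x)\<bar>) * indicator (- cball 0 (real R)) x \<partial>lborel)"

lemma log_tail_antimono: "R \<le> R' \<Longrightarrow> log_tail f R' q \<le> log_tail f R q"
  unfolding log_tail_def
  by (intro nn_integral_mono mult_left_mono) (auto simp: indicator_def)

text \<open>Lower semicontinuity in the parameter, by Fatou's lemma.\<close>

lemma log_tail_lsc:
  assumes [measurable]: "f \<in> borel_measurable borel"
    and q: "u \<longlonglongrightarrow> q" "0 < snd q" and le: "\<And>n. log_tail f R (u n) \<le> e"
  shows "log_tail f R q \<le> e"
proof -
  have [measurable]: "cball (0::real^'n) r \<in> sets borel" for r
    by simp
  let ?g = "\<lambda>q x. ennreal (f x * \<bar>ln (kern \<kappa> q x)\<bar>) * indicator (- cball 0 (real R)) x"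
  have "(\<lambda>n. ?g (u n) x) \<longlonglongrightarrow> ?g q x" for x
  proof -
    have "(\<lambda>n. ln (kern \<kappa> (u n) x)) \<longlonglongrightarrow> ln (kern \<kappa> q x)"
      using kern_pos[OF q(2), of x] by (intro tendsto_ln kern_tendsto q tendsto_const) auto
    then have "(\<lambda>n. ennreal (f x * \<bar>ln (kern \<kappa> (u n) x)\<bar>)) \<longlonglongrightarrow> ennreal (f x * \<bar>ln (kern \<kappa> q x)\<bar>)"
      by (intro tendsto_ennrealI tendsto_mult tendsto_const tendsto_rabs)
    then show ?thesis
      by (cases "x \<in> cball 0 (real R)") auto
  qed
  then have "log_tail f R q = (\<integral>\<^sup>+x. liminf (\<lambda>n. ?g (u n) x) \<partial>lborel)"
    unfolding log_tail_def by (intro nn_integral_cong) (metis (no_types, lifting) lim_imp_Liminf trivial_limit_sequentially)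
  also have "\<dots> \<le> liminf (\<lambda>n. log_tail f R (u n))"
    unfolding log_tail_def by (intro nn_integral_liminf) measurable
  also have "\<dots> \<le> limsup (\<lambda>n. log_tail f R (u n))"
    by (rule Liminf_le_Limsup) simp
  also have "\<dots> \<le> e"
    by (rule Limsup_bounded) (simp add: le)
  finally show ?thesis .
qed

text \<open>At each parameter the tail tends to \<open>0\<close> as the radius grows, hence the sublevel sets of the tails
  cover the parameter space. They are closed by lower semicontinuity, so Baire's theorem yields a
  ball inside one of them. Pointwise smallness becomes uniform on some ball, although its position
  cannot be prescribed.\<close>

lemma log_tail_uniformly_small:
  assumes int: "integrable lborel f" and nonneg: "\<And>x. 0 \<le> f x"
    and log_int: "\<And>a b. 0 < b \<Longrightarrow> integrable lborel (\<lambda>x. f x * \<bar>ln (\<kappa> ((x - a) /\<^sub>R b))\<bar>)"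
    and "0 < e"
  shows "\<exists>p r R. 0 < r \<and> cball p r \<subseteq> loc_scale \<and> (\<forall>q\<in>cball p r. log_tail f R q \<le> ennreal e)"
proof -
  have [measurable]: "f \<in> borel_measurable borel"
    using int by auto
  \<comment> \<open>the logarithm of the scale as parameter: Baire's theorem needs a closed parameter space\<close>
  define \<Phi> :: "(real ^ 'n) \<times> real \<Rightarrow> (real ^ 'n) \<times> real" where "\<Phi> z = (fst z, exp (snd z))" for z
  define E where "E n = {z. log_tail f n (\<Phi> z) \<le> ennreal e}" for n
  have "closed (E n)" for n
    unfolding closed_sequential_limits E_def
  proof (intro allI impI, elim conjE)
    fix u z assume u: "\<forall>i. u i \<in> {z. log_tail f n (\<Phi> z) \<le> ennreal e}" "u \<longlonglongrightarrow> z"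
    have "log_tail f n (\<Phi> z) \<le> ennreal e"
    proof (rule log_tail_lsc)
      show "(\<lambda>i. \<Phi> (u i)) \<longlonglongrightarrow> \<Phi> z"
        unfolding \<Phi>_def by (intro tendsto_intros u(2))
    qed (use u(1) in \<open>auto simp: \<Phi>_def\<close>)
    then show "z \<in> {z. log_tail f n (\<Phi> z) \<le> ennreal e}" by simp
  qed
  moreover have "(\<Union>n. E n) = UNIV"
  proof -
    have "\<exists>n. z \<in> E n" for z
    proof -
      have "integrable lborel (\<lambda>x. f x * \<bar>ln (kern \<kappa> (\<Phi> z) x)\<bar>)"
        by (intro log_kern_integrable int nonneg log_int) (auto simp: \<Phi>_def)
      then have "(\<integral>\<^sup>+x. ennreal \<bar>f x * \<bar>ln (kern \<kappa> (\<Phi> z) x)\<bar>\<bar> \<partial>lborel) < \<infinity>"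
        by (simp add: integrable_iff_bounded)
      then obtain n where "(\<integral>\<^sup>+x. ennreal \<bar>f x * \<bar>ln (kern \<kappa> (\<Phi> z) x)\<bar>\<bar> * indicator (- cball 0 (real n)) x \<partial>lborel) \<le> ennreal e"
        using L1_tail_small[of "\<lambda>x. f x * \<bar>ln (kern \<kappa> (\<Phi> z) x)\<bar>" e] \<open>0 < e\<close> by auto
      then show ?thesis
        using nonneg by (auto simp: E_def log_tail_def abs_mult)
    qed
    then show ?thesis by blast
  qed
  ultimately obtain n z where z: "z \<in> interior (E n)"
    using closed_union_UNIV_has_interior[of E] by auto
  define V where "V = {q. 0 < snd q} \<inter> (\<lambda>q. (fst q, ln (snd q))) -` interior (E n)"
  have "open V"
    unfolding V_def
  proof (rule continuous_open_preimage)
    show "continuous_on {q::(real ^ 'n) \<times> real. 0 < snd q} (\<lambda>q. (fst q, ln (snd q)))"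
      by (intro continuous_intros) auto
    show "open {q::(real ^ 'n) \<times> real. 0 < snd q}"
      by (intro open_Collect_less continuous_intros)
  qed simp
  moreover have "\<Phi> z \<in> V"
    using z by (simp add: V_def \<Phi>_def)
  ultimately obtain r where r: "0 < r" "cball (\<Phi> z) r \<subseteq> V"
    using open_contains_cball by blast
  have "log_tail f n q \<le> ennreal e" if "q \<in> V" for q
  proof -
    have "(fst q, ln (snd q)) \<in> E n"
      using that interior_subset by (auto simp: V_def)
    then show ?thesis
      using that by (simp add: E_def \<Phi>_def V_def)
  qed
  moreover have "V \<subseteq> loc_scale"
    by (auto simp: V_def loc_scale_def)
  ultimately show ?thesis
    using r by blast
qed

end

section \<open>Weak neighbourhoods of finitely supported measures\<close>

lemma prob_measures_iff:
  "P \<in> prob_measures S \<longleftrightarrow> sets P = sets (restrict_space borel S) \<and> prob_space P"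
  by (auto simp: prob_measures_def space_prob_algebra)

lemma prob_measures_space: "P \<in> prob_measures S \<Longrightarrow> space P = S"
  by (auto simp: prob_measures_iff space_restrict_space dest: sets_eq_imp_space_eq)

lemma openin_weak_topology_basic:
  fixes g :: "'a::topological_space \<Rightarrow> real"
  assumes "continuous_on S g" "bounded (g ` S)" "open U"
  shows "openin (weak_topology S) {P \<in> prob_measures S. (\<integral>s. g s \<partial>P) \<in> U}"
  unfolding weak_topology_def
  by (rule topology_generated_by_Basis) (use assms in blast)

lemma topspace_weak_topology: "topspace (weak_topology S) = prob_measures S"
proof
  show "topspace (weak_topology S) \<subseteq> prob_measures S"
    unfolding weak_topology_def topology_generated_by_topspace by (rule Union_least) auto
  show "prob_measures S \<subseteq> topspace (weak_topology S)"
  proof -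
    have "bounded ((\<lambda>_. 0::real) ` S)"
      by (rule boundedI[where B=0]) auto
    then have "openin (weak_topology S) {P \<in> prob_measures S. (\<integral>s. (0::real) \<partial>P) \<in> UNIV}"
      by (intro openin_weak_topology_basic continuous_on_const open_UNIV)
    moreover have "{P \<in> prob_measures S. (\<integral>s. (0::real) \<partial>P) \<in> UNIV} = prob_measures S"
      by blast
    ultimately show ?thesis
      using openin_subset by metis
  qed
qed

text \<open>The open condition is imposed on the integral of a tent function that equals \<open>1\<close> at \<open>p\<close> and
  vanishes outside the ball: it lies above the indicator of \<open>{p}\<close> and below that of the ball.\<close>

lemma weak_neighbourhood_ball:
  fixes S :: "'a::metric_space set"
  assumes P0: "P0 \<in> prob_measures S" and p: "p \<in> S" "0 < r" and c: "c < measure P0 {p}"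
  shows "\<exists>U. openin (weak_topology S) U \<and> P0 \<in> U \<and> (\<forall>P\<in>U. c < measure P (ball p r \<inter> S))"
proof -
  define \<phi> where "\<phi> q = max 0 (1 - dist q p / r)" for q
  have \<phi>_cont: "continuous_on X \<phi>" for X
    unfolding \<phi>_def using p(2) by (intro continuous_intros) auto
  have \<phi>_bd: "0 \<le> \<phi> q" "\<phi> q \<le> 1" for q
    using p(2) by (auto simp: \<phi>_def)
  have \<phi>_ball: "\<phi> q = 0" if "q \<notin> ball p r" for q
    using that p(2) by (auto simp: \<phi>_def dist_commute field_simps)
  have meas: "\<phi> \<in> borel_measurable P" "{p} \<in> sets P" "ball p r \<inter> S \<in> sets P" "integrable P \<phi>"
    if "P \<in> prob_measures S" for P
  proof -
    interpret prob_space P using that by (simp add: prob_measures_iff)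
    have sets: "sets P = sets (restrict_space borel S)" using that by (simp add: prob_measures_iff)
    have "\<phi> \<in> borel_measurable (restrict_space borel S)"
      using \<phi>_cont by (intro borel_measurable_continuous_on_restrict)
    then show m: "\<phi> \<in> borel_measurable P"
      using measurable_cong_sets[OF sets refl] by blast
    have "S \<inter> {p} \<in> sets (restrict_space borel S)" "S \<inter> ball p r \<in> sets (restrict_space borel S)"
      by (auto simp: sets_restrict_space)
    then show "{p} \<in> sets P" "ball p r \<inter> S \<in> sets P"
      using p(1) by (auto simp: sets Int_commute)
    show "integrable P \<phi>"
      using \<phi>_bd by (intro integrable_const_bound[where B=1] m) auto
  qed
  let ?U = "{P \<in> prob_measures S. (\<integral>s. \<phi> s \<partial>P) \<in> {c<..}}"
  have "openin (weak_topology S) ?U"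
    using \<phi>_bd by (intro openin_weak_topology_basic \<phi>_cont) (auto intro!: boundedI[where B=1])
  moreover have "P0 \<in> ?U"
  proof -
    interpret prob_space P0 using P0 by (simp add: prob_measures_iff)
    have "measure P0 {p} = (\<integral>s. indicator {p} s \<partial>P0)"
      using meas(2)[OF P0] by simp
    also have "\<dots> \<le> (\<integral>s. \<phi> s \<partial>P0)"
    proof (rule integral_mono)
      show "indicator {p} s \<le> \<phi> s" for s
        using \<phi>_bd by (cases "s = p") (simp_all add: \<phi>_def)
      show "integrable P0 (indicat_real {p})"
        using meas(2)[OF P0] by (intro integrable_real_indicator) (simp_all add: emeasure_eq_measure)
    qed (rule meas(4)[OF P0])
    finally show ?thesis using P0 c by simp
  qed
  moreover have "c < measure P (ball p r \<inter> S)" if "P \<in> ?U" for P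
  proof -
    have P: "P \<in> prob_measures S" "c < (\<integral>s. \<phi> s \<partial>P)" using that by auto
    interpret prob_space P using P by (simp add: prob_measures_iff)
    note P(2)
    also have "(\<integral>s. \<phi> s \<partial>P) \<le> (\<integral>s. indicator (ball p r \<inter> S) s \<partial>P)"
    proof (rule integral_mono)
      show "\<phi> s \<le> indicator (ball p r \<inter> S) s" if "s \<in> space P" for s
        using that prob_measures_space[OF P(1)] \<phi>_bd[of s] \<phi>_ball[of s]
        by (cases "s \<in> ball p r") simp_all
      show "integrable P (indicat_real (ball p r \<inter> S))"
        using meas(3)[OF P(1)] by (intro integrable_real_indicator) (simp_all add: emeasure_eq_measure)
    qed (rule meas(4)[OF P(1)])
    also have "\<dots> = measure P (ball p r \<inter> S)"
      using meas(3)[OF P(1)] by simp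
    finally show ?thesis .
  qed
  ultimately show ?thesis by blast
qed

lemma weak_neighbourhood_balls:
  fixes S :: "'a::metric_space set"
  assumes P0: "P0 \<in> prob_measures S" and A: "finite A" "A \<subseteq> S" "\<And>p. p \<in> A \<Longrightarrow> 0 < r p"
    and c: "\<And>p. p \<in> A \<Longrightarrow> c p < measure P0 {p}"
  shows "\<exists>U. openin (weak_topology S) U \<and> P0 \<in> U \<and> (\<forall>P\<in>U. \<forall>p\<in>A. c p < measure P (ball p (r p) \<inter> S))"
proof -
  have "\<forall>p\<in>A. \<exists>U. openin (weak_topology S) U \<and> P0 \<in> U \<and> (\<forall>P\<in>U. c p < measure P (ball p (r p) \<inter> S))"
    using weak_neighbourhood_ball[OF P0 subsetD[OF A(2)] A(3) c] by simp
  then obtain U where U: "\<And>p. p \<in> A \<Longrightarrow> openin (weak_topology S) (U p)" "\<And>p. p \<in> A \<Longrightarrow> P0 \<in> U p"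
      "\<And>p P. p \<in> A \<Longrightarrow> P \<in> U p \<Longrightarrow> c p < measure P (ball p (r p) \<inter> S)"
    by metis
  have "openin (weak_topology S) ((\<Inter>p\<in>A. U p) \<inter> topspace (weak_topology S))"
    by (intro openin_INT U A(1))
  then show ?thesis
    using U P0 by (intro exI[of _ "(\<Inter>p\<in>A. U p) \<inter> topspace (weak_topology S)"])
      (auto simp: topspace_weak_topology)
qed

lemma finitely_supported_prob_measure:
  fixes S :: "'a::metric_space set"
  assumes A: "finite A" "A \<subseteq> S" "p \<in> S" and w: "\<And>a. a \<in> A \<Longrightarrow> 0 \<le> w a" "sum w A \<le> 1"
  shows "\<exists>P\<in>prob_measures S. (\<forall>a\<in>A. w a \<le> measure P {a}) \<and> 1 - sum w A \<le> measure P {p}"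
proof -
  \<comment> \<open>the weights \<open>w\<close>, plus the remaining mass at \<open>p\<close>, which may itself belong to \<open>A\<close>\<close>
  define v where "v a = (if a \<in> A then w a else 0) + (if a = p then 1 - sum w A else 0)" for a
  have v_nonneg: "0 \<le> v a" for a
    using w by (auto simp: v_def)
  have "(\<integral>\<^sup>+a. ennreal (v a) \<partial>count_space UNIV) = (\<integral>\<^sup>+a. ennreal (v a) \<partial>count_space (insert p A))"
    by (rule nn_integral_count_space_eq) (auto simp: v_def)
  also have "\<dots> = ennreal (\<Sum>a\<in>insert p A. v a)"
    using A(1) v_nonneg by (subst nn_integral_count_space_finite) (auto simp: sum_ennreal)
  also have "(\<Sum>a\<in>insert p A. v a) = 1"
  proof -
    have "(\<Sum>a\<in>insert p A. if a \<in> A then w a else 0) = sum w A"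
      using A(1) by (simp add: sum.If_cases Int_absorb1 subset_insertI)
    moreover have "(\<Sum>a\<in>insert p A. if a = p then 1 - sum w A else 0) = 1 - sum w A"
      using A(1) by (subst sum.delta) auto
    ultimately show ?thesis
      unfolding v_def sum.distrib by simp
  qed
  finally have v_sum: "(\<integral>\<^sup>+a. ennreal (v a) \<partial>count_space UNIV) = 1" by simp
  define m where "m = embed_pmf v"
  have m: "pmf m a = v a" for a
    unfolding m_def using v_nonneg v_sum by (rule pmf_embed_pmf)
  define f where "f a = (if a \<in> S then a else p)" for a
  define P where "P = distr (measure_pmf m) (restrict_space borel S) f"
  have f: "f \<in> measurable (measure_pmf m) (restrict_space borel S)"
    using A(3) by (auto simp: f_def space_restrict_space)
  have P: "P \<in> prob_measures S"
    unfolding prob_measures_iff P_def using measure_pmf.prob_space_distr[OF f] by simp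
  have "v a \<le> measure P {a}" if "a \<in> S" for a
  proof -
    have "S \<inter> {a} \<in> sets (restrict_space borel S)"
      by (auto simp: sets_restrict_space)
    then have a: "{a} \<in> sets (restrict_space borel S)"
      using that by simp
    have "v a = measure (measure_pmf m) {a}"
      by (simp add: m measure_pmf_single)
    also have "\<dots> \<le> measure (measure_pmf m) (f -` {a})"
      using that by (intro measure_pmf.finite_measure_mono) (auto simp: f_def)
    also have "\<dots> = measure P {a}"
      unfolding P_def using f a by (subst measure_distr) auto
    finally show ?thesis .
  qed
  moreover have "w a \<le> v a" if "a \<in> A" for a
    using w that by (simp add: v_def)
  moreover have "1 - sum w A \<le> v p"
    using w by (simp add: v_def)
  ultimately show ?thesis
    using P A by (intro bexI[of _ P]) (auto intro: order_trans)
qed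

section \<open>Mixture densities and the induced prior\<close>

text \<open>The family that generates the sigma-algebra of \<^const>\<open>induced_prior\<close> is already a
  sigma-algebra, so that its measurable sets are exactly those with measurable preimage.\<close>

lemma sets_pushforward_sigma:
  assumes "f \<in> space Q \<rightarrow> X"
  shows "sets (sigma X {A. A \<subseteq> X \<and> f -` A \<inter> space Q \<in> sets Q}) = {A. A \<subseteq> X \<and> f -` A \<inter> space Q \<in> sets Q}"
proof -
  let ?\<A> = "{A. A \<subseteq> X \<and> f -` A \<inter> space Q \<in> sets Q}"
  have "sigma_algebra X ?\<A>"
    unfolding sigma_algebra_iff2
  proof (intro conjI ballI allI impI)
    fix A assume A: "A \<in> ?\<A>"
    have "f -` (X - A) \<inter> space Q = space Q - (f -` A \<inter> space Q)"
      using assms by auto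
    then show "X - A \<in> ?\<A>"
      using A by auto
  next
    fix A :: "nat \<Rightarrow> _" assume A: "range A \<subseteq> ?\<A>"
    have "f -` (\<Union>i. A i) \<inter> space Q = (\<Union>i. f -` A i \<inter> space Q)"
      by auto
    moreover have "(\<Union>i. f -` A i \<inter> space Q) \<in> sets Q"
      using A by (intro sets.countable_UN) auto
    ultimately show "(\<Union>i. A i) \<in> ?\<A>"
      using A by auto
  qed auto
  then have "sigma_sets X ?\<A> = ?\<A>"
    by (rule sigma_algebra.sigma_sets_eq)
  then show ?thesis
    by (subst sets_measure_of) auto
qed

context positive_kernel
begin

text \<open>The mixture as an extended nonnegative integral. Unlike the Bochner integral it keeps the value
  \<open>\<infinity>\<close>, and it obeys Tonelli's theorem; the two agree almost everywhere.\<close>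

definition mixture_nn :: "((real ^ 'n) \<times> real) measure \<Rightarrow> real ^ 'n \<Rightarrow> ennreal" where
  "mixture_nn P x = (\<integral>\<^sup>+p. ennreal (kern \<kappa> p x) \<partial>P)"

lemma measurable_prob_measures:
  assumes "P \<in> prob_measures loc_scale" "f \<in> borel_measurable borel"
  shows "f \<in> borel_measurable P"
proof -
  have "sets P = sets (restrict_space borel loc_scale)"
    using assms(1) by (simp add: prob_measures_iff)
  then show ?thesis
    using measurable_restrict_space1[OF assms(2)] measurable_cong_sets by blast
qed

lemma measurable_prob_measures_pair:
  assumes "P \<in> prob_measures loc_scale" "f \<in> borel_measurable (borel \<Otimes>\<^sub>M borel)"
  shows "f \<in> borel_measurable (P \<Otimes>\<^sub>M (borel :: (real ^ 'n) measure))"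
proof -
  have "(\<lambda>z. z) \<in> measurable P borel"
    using assms(1) by (rule measurable_prob_measures) simp
  then have "(\<lambda>z. (fst z, snd z)) \<in> measurable (P \<Otimes>\<^sub>M (borel :: (real ^ 'n) measure)) (borel \<Otimes>\<^sub>M borel)"
    by (intro measurable_Pair measurable_compose[OF measurable_fst] measurable_snd)
  from measurable_compose[OF this assms(2)] show ?thesis
    by simp
qed

lemma kern_pos_loc_scale: "p \<in> loc_scale \<Longrightarrow> 0 < kern \<kappa> p x"
  by (rule kern_pos) (auto simp: loc_scale_def)

lemma mixture_density_eq:
  assumes "P \<in> prob_measures loc_scale"
  shows "mixture_density \<kappa> P x = enn2real (mixture_nn P x)"
proof -
  have "mixture_density \<kappa> P x = (\<integral>p. kern \<kappa> p x \<partial>P)"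
    unfolding mixture_density_def kern_def by (simp add: case_prod_unfold)
  also have "\<dots> = enn2real (mixture_nn P x)"
    unfolding mixture_nn_def
  proof (rule integral_eq_nn_integral)
    show "(\<lambda>p. kern \<kappa> p x) \<in> borel_measurable P"
      by (rule measurable_prob_measures[OF assms]) measurable
    show "AE p in P. 0 \<le> kern \<kappa> p x"
      by (rule AE_I2) (auto simp: prob_measures_space[OF assms] intro: less_imp_le kern_pos_loc_scale)
  qed
  finally show ?thesis .
qed

lemma mixture_nn_measurable_pair:
  "(\<lambda>(P, x). mixture_nn P x) \<in> borel_measurable (prob_algebra (restrict_space borel loc_scale) \<Otimes>\<^sub>M borel)"
proof -
  let ?N = "restrict_space (borel :: ((real ^ 'n) \<times> real) measure) loc_scale"
  let ?M = "prob_algebra ?N \<Otimes>\<^sub>M (borel :: (real ^ 'n) measure)"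
  have "(\<lambda>z. mixture_nn (fst z) (snd z)) \<in> borel_measurable ?M"
    unfolding mixture_nn_def
  proof (rule nn_integral_measurable_subprob_algebra2)
    have "(\<lambda>z. (snd z, snd (fst z))) \<in> measurable (?M \<Otimes>\<^sub>M ?N) (borel \<Otimes>\<^sub>M borel)"
      by (intro measurable_Pair measurable_compose[OF measurable_snd measurable_restrict_space1]) measurable
    from measurable_compose[OF this kern_measurable_pair]
    have "(\<lambda>z. kern \<kappa> (snd z) (snd (fst z))) \<in> borel_measurable (?M \<Otimes>\<^sub>M ?N)"
      by simp
    then show "(\<lambda>(z, p). ennreal (kern \<kappa> p (snd z))) \<in> borel_measurable (?M \<Otimes>\<^sub>M ?N)"
      by (simp add: case_prod_unfold)
    show "fst \<in> measurable ?M (subprob_algebra ?N)"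
      by (rule measurable_prob_algebraD) measurable
  qed
  then show ?thesis by (simp add: case_prod_unfold)
qed

lemma mixture_nn_measurable:
  assumes "P \<in> prob_measures loc_scale"
  shows "mixture_nn P \<in> borel_measurable borel"
proof -
  have "P \<in> space (prob_algebra (restrict_space borel loc_scale))"
    using assms by (simp add: prob_measures_def)
  from measurable_compose_Pair1[OF this mixture_nn_measurable_pair] show ?thesis
    by simp
qed

lemma nn_integral_mixture_swap:
  fixes f :: "((real ^ 'n) \<times> real) \<times> (real ^ 'n) \<Rightarrow> ennreal"
  assumes P: "P \<in> prob_measures loc_scale"
    and [measurable]: "f \<in> borel_measurable (borel \<Otimes>\<^sub>M borel)"
  shows "(\<integral>\<^sup>+x. \<integral>\<^sup>+p. f (p, x) \<partial>P \<partial>lborel) = (\<integral>\<^sup>+p. \<integral>\<^sup>+x. f (p, x) \<partial>lborel \<partial>P)"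
proof -
  interpret P: prob_space P using P by (simp add: prob_measures_iff)
  interpret pair_sigma_finite P "lborel :: (real ^ 'n) measure" ..
  have "f \<in> borel_measurable (P \<Otimes>\<^sub>M (borel :: (real ^ 'n) measure))"
    by (rule measurable_prob_measures_pair[OF P]) measurable
  then have "f \<in> borel_measurable (P \<Otimes>\<^sub>M lborel)"
    by (simp cong: measurable_cong_sets sets_pair_measure_cong)
  then show ?thesis
    by (intro Fubini') simp
qed

lemma nn_integral_mixture_nn:
  assumes P: "P \<in> prob_measures loc_scale"
  shows "(\<integral>\<^sup>+x. mixture_nn P x \<partial>lborel) = 1"
proof -
  interpret P: prob_space P using P by (simp add: prob_measures_iff)
  have "(\<lambda>z. ennreal (kern \<kappa> (fst z) (snd z))) \<in> borel_measurable (borel \<Otimes>\<^sub>M borel)"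
    by measurable
  from nn_integral_mixture_swap[OF P this]
  have "(\<integral>\<^sup>+x. mixture_nn P x \<partial>lborel) = (\<integral>\<^sup>+p. \<integral>\<^sup>+x. ennreal (kern \<kappa> p x) \<partial>lborel \<partial>P)"
    by (simp add: mixture_nn_def)
  also have "\<dots> = (\<integral>\<^sup>+p. 1 \<partial>P)"
    by (intro nn_integral_cong nn_integral_kern) (auto simp: prob_measures_space[OF P] loc_scale_def)
  finally show ?thesis
    by (simp add: P.emeasure_space_1)
qed

lemma AE_mixture_nn_finite:
  assumes "P \<in> prob_measures loc_scale"
  shows "AE x in lborel. mixture_nn P x = ennreal (mixture_density \<kappa> P x)"
proof -
  have "AE x in lborel. mixture_nn P x \<noteq> \<infinity>"
    using mixture_nn_measurable[OF assms] nn_integral_mixture_nn[OF assms]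
    by (intro nn_integral_PInf_AE) auto
  then show ?thesis
    by eventually_elim (simp add: mixture_density_eq[OF assms] less_top)
qed

lemma mixture_density_measurable:
  assumes "P \<in> prob_measures loc_scale"
  shows "mixture_density \<kappa> P \<in> borel_measurable borel"
proof -
  note [measurable] = mixture_nn_measurable[OF assms]
  have "(\<lambda>x. enn2real (mixture_nn P x)) \<in> borel_measurable borel"
    by measurable
  then show ?thesis
    by (simp add: mixture_density_eq[OF assms, abs_def])
qed

lemma mixture_density_prob_density:
  assumes "P \<in> prob_measures loc_scale"
  shows "mixture_density \<kappa> P \<in> prob_densities"
proof -
  have "(\<integral>\<^sup>+x. ennreal (mixture_density \<kappa> P x) \<partial>lborel) = (\<integral>\<^sup>+x. mixture_nn P x \<partial>lborel)"
    using AE_mixture_nn_finite[OF assms] by (intro nn_integral_cong_AE) auto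
  then show ?thesis
    using mixture_density_measurable[OF assms]
    by (simp add: prob_densities_def nn_integral_mixture_nn[OF assms] mixture_density_eq[OF assms])
qed

lemma log_ratio_mixture_measurable:
  assumes [measurable]: "f \<in> borel_measurable borel"
  shows "(\<lambda>P. log_ratio_integral f (mixture_density \<kappa> P)) \<in>
           borel_measurable (prob_algebra (restrict_space borel loc_scale))"
proof -
  let ?A = "prob_algebra (restrict_space (borel :: ((real ^ 'n) \<times> real) measure) loc_scale)"
  \<comment> \<open>the integrand of the logarithmic ratio in terms of a jointly measurable version of the mixture\<close>
  define H :: "((real ^ 'n) \<times> real) measure \<Rightarrow> real ^ 'n \<Rightarrow> ereal" where
    "H P x = (if f x = 0 then 0 else if enn2real (mixture_nn P x) = 0 then \<infinity>
              else ereal (f x * ln (f x / enn2real (mixture_nn P x))))" for P x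
  have [measurable]: "(\<lambda>z. mixture_nn (fst z) (snd z)) \<in> borel_measurable (?A \<Otimes>\<^sub>M borel)"
    using mixture_nn_measurable_pair by (simp add: case_prod_unfold)
  have [measurable]: "(\<lambda>(P, x). H P x) \<in> borel_measurable (?A \<Otimes>\<^sub>M lborel)"
    unfolding H_def case_prod_unfold by measurable
  have "(\<lambda>P. ext_integral lborel (H P)) \<in> borel_measurable ?A"
    unfolding ext_integral_def
    by (intro borel_measurable_ereal_diff measurable_compose[OF lborel.borel_measurable_nn_integral measurable_enn2ereal])
       measurable
  moreover have "log_ratio_integral f (mixture_density \<kappa> P) = ext_integral lborel (H P)" if "P \<in> space ?A" for P
  proof -
    have "P \<in> prob_measures loc_scale"
      using that by (simp add: prob_measures_def)
    then show ?thesis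
      unfolding log_ratio_integral_def H_def by (simp only: mixture_density_eq)
  qed
  ultimately show ?thesis
    by (subst measurable_cong) auto
qed

text \<open>It suffices that the event contains a set of positive prior mass; the measurability of the event
  itself is established here.\<close>

theorem KL_support_induced_priorI:
  assumes Q: "Q \<in> priors loc_scale" and [measurable]: "f \<in> borel_measurable borel"
    and U: "\<And>\<epsilon>::real. 0 < \<epsilon> \<Longrightarrow> \<exists>U. 0 < emeasure Q U \<and>
              (\<forall>P\<in>U. P \<in> prob_measures loc_scale \<and> log_ratio_integral f (mixture_density \<kappa> P) < ereal \<epsilon>)"
  shows "f \<in> KL_support (induced_prior \<kappa> Q)"
proof -
  let ?A = "prob_algebra (restrict_space (borel :: ((real ^ 'n) \<times> real) measure) loc_scale)"
  let ?\<A> = "{A. A \<subseteq> prob_densities \<and> mixture_density \<kappa> -` A \<inter> space Q \<in> sets Q}"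
  have setsQ: "sets Q = sets ?A"
    using Q by (simp add: priors_def space_prob_algebra)
  then have spaceQ: "space Q = prob_measures loc_scale"
    unfolding prob_measures_def by (rule sets_eq_imp_space_eq)
  have into: "mixture_density \<kappa> \<in> space Q \<rightarrow> prob_densities"
    using mixture_density_prob_density by (auto simp: spaceQ)
  note sets = sets_pushforward_sigma[OF into]
  have meas: "mixture_density \<kappa> \<in> measurable Q (sigma prob_densities ?\<A>)"
    by (rule measurableI) (use into in \<open>auto simp: sets space_measure_of_conv\<close>)
  show ?thesis
    unfolding KL_support_def
  proof (intro CollectI allI impI)
    fix \<epsilon> :: real assume "0 < \<epsilon>"
    then obtain U where U: "0 < emeasure Q U" "\<And>P. P \<in> U \<Longrightarrow> P \<in> prob_measures loc_scale"
        "\<And>P. P \<in> U \<Longrightarrow> log_ratio_integral f (mixture_density \<kappa> P) < ereal \<epsilon>"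
      using assms(3) by blast
    define V where "V = {g \<in> prob_densities. log_ratio_integral f g < ereal \<epsilon>}"
    have pre: "mixture_density \<kappa> -` V \<inter> space Q = {P \<in> space Q. log_ratio_integral f (mixture_density \<kappa> P) < ereal \<epsilon>}"
      using into by (auto simp: V_def)
    have "(\<lambda>P. log_ratio_integral f (mixture_density \<kappa> P)) \<in> borel_measurable Q"
      using log_ratio_mixture_measurable[of f] measurable_cong_sets[OF setsQ refl] by auto
    then have "{P \<in> space Q. log_ratio_integral f (mixture_density \<kappa> P) < ereal \<epsilon>} \<in> sets Q"
      by measurable
    then have preQ: "mixture_density \<kappa> -` V \<inter> space Q \<in> sets Q"
      by (simp add: pre)
    then have V: "V \<in> sets (sigma prob_densities ?\<A>)"
      unfolding sets by (auto simp: V_def)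
    have "0 < emeasure Q U" by fact
    also have "\<dots> \<le> emeasure Q (mixture_density \<kappa> -` V \<inter> space Q)"
      using U preQ by (intro emeasure_mono) (auto simp: V_def spaceQ intro: mixture_density_prob_density)
    also have "\<dots> = emeasure (induced_prior \<kappa> Q) V"
      unfolding induced_prior_def by (rule emeasure_distr[OF meas V, symmetric])
    also have "V = {g \<in> space (induced_prior \<kappa> Q). log_ratio_integral f g < ereal \<epsilon>}"
      by (simp add: V_def induced_prior_def space_measure_of_conv)
    finally show "0 < emeasure (induced_prior \<kappa> Q) {g \<in> space (induced_prior \<kappa> Q). log_ratio_integral f g < ereal \<epsilon>}" .
  qed
qed

end

section \<open>Lower bounds for mixtures in a weak neighbourhood\<close>

lemma open_loc_scale: "open (loc_scale :: ((real ^ 'n::finite) \<times> real) set)"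
  unfolding loc_scale_def by (intro open_Times) auto

lemma borel_sets_prob_measures:
  assumes "P \<in> prob_measures loc_scale" "K \<in> sets borel" "K \<subseteq> loc_scale"
  shows "K \<in> sets P"
  using assms by (auto simp: prob_measures_iff sets_restrict_space)

lemma ennreal_diff_le:
  assumes "0 \<le> b" "ennreal a \<le> ennreal b + e"
  shows "ennreal (a - b) \<le> e"
proof (cases e)
  case (real r)
  then show ?thesis
    using assms by (auto simp: ennreal_plus[symmetric] ennreal_le_iff2 intro!: ennreal_leI simp del: ennreal_plus)
qed simp

text \<open>Disjointness allows the contributions of the balls to a mixture to be added.\<close>

lemma disjoint_balls_radii:
  fixes A :: "'a::metric_space set"
  assumes "finite A" "\<And>a. a \<in> A \<Longrightarrow> 0 < r0 a"
  shows "\<exists>r. (\<forall>a\<in>A. 0 < r a \<and> r a \<le> r0 a) \<and> disjoint_family_on (\<lambda>a. ball a (r a)) A"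
proof -
  have "\<forall>a. \<exists>d>0. \<forall>x\<in>A. x \<noteq> a \<longrightarrow> d \<le> dist a x"
    using finite_set_avoid[OF assms(1)] by blast
  then obtain d where d: "\<And>a. 0 < d a" "\<And>a x. x \<in> A \<Longrightarrow> x \<noteq> a \<Longrightarrow> d a \<le> dist a x"
    by metis
  let ?r = "\<lambda>a. min (r0 a) (d a / 2)"
  have "ball a (?r a) \<inter> ball b (?r b) = {}" if "a \<in> A" "b \<in> A" "a \<noteq> b" for a b
  proof (rule ccontr)
    assume "ball a (?r a) \<inter> ball b (?r b) \<noteq> {}"
    then obtain x where "dist a x < d a / 2" "dist b x < d b / 2" by auto
    moreover have "d a \<le> dist a b" "d b \<le> dist a b"
      using d(2)[of b a] d(2)[of a b] that by (auto simp: dist_commute)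
    ultimately show False
      using dist_triangle2[of a b x] by linarith
  qed
  then show ?thesis
    using assms(2) d(1) by (intro exI[of _ ?r]) (auto simp: disjoint_family_on_def)
qed

context positive_kernel
begin

lemma mixture_density_nonneg:
  "P \<in> prob_measures loc_scale \<Longrightarrow> 0 \<le> mixture_density \<kappa> P x"
  by (simp add: mixture_density_eq)

text \<open>Restricting \<open>P\<close> to the disjoint balls only decreases its mixture. On the ball around \<open>p\<close>, replacing
  the kernels by \<open>kern \<kappa> p\<close> costs at most \<open>\<tau>\<close> times the mass of the ball in \<open>L\<^sup>1\<close>, and missing
  mass \<open>\<delta>\<close> costs at most \<open>\<delta>\<close>. A surplus of mass in a ball only helps, which is why the
  estimate concerns the positive part of the difference.\<close>

lemma nn_integral_mixture_deficit_le:
  assumes P: "P \<in> prob_measures loc_scale" and A: "finite A" "A \<subseteq> loc_scale"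
    and w: "\<And>p. p \<in> A \<Longrightarrow> w p \<le> measure P (ball p (r p) \<inter> loc_scale) + \<delta>"
    and \<delta>: "0 \<le> \<delta>" "real (card A) * \<delta> \<le> \<tau>"
    and disj: "disjoint_family_on (\<lambda>p. ball p (r p)) A"
    and close: "\<And>p q. p \<in> A \<Longrightarrow> q \<in> ball p (r p) \<Longrightarrow> L1_dist (kern \<kappa> q) (kern \<kappa> p) \<le> ennreal \<tau>"
  shows "(\<integral>\<^sup>+x. ennreal ((\<Sum>p\<in>A. w p * kern \<kappa> p x) - mixture_density \<kappa> P x) \<partial>lborel) \<le> ennreal (2 * \<tau>)"
proof -
  interpret P: prob_space P using P by (simp add: prob_measures_iff)
  have "0 \<le> \<tau>" using \<delta> by (meson mult_nonneg_nonneg of_nat_0_le_iff order_trans)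
  define K where "K p = ball p (r p) \<inter> loc_scale" for p
  have K_borel [measurable]: "K p \<in> sets borel" for p
    unfolding K_def by (intro borel_open open_Int open_ball open_loc_scale)
  have K_sets: "K p \<in> sets P" for p
    by (rule borel_sets_prob_measures[OF P K_borel]) (auto simp: K_def)
  have K_disj: "disjoint_family_on K A"
    using disj unfolding disjoint_family_on_def K_def by blast
  have meas_P: "f \<in> borel_measurable borel \<Longrightarrow> f \<in> borel_measurable P" for f :: "_ \<Rightarrow> ennreal"
    by (rule measurable_prob_measures[OF P])
  \<comment> \<open>by disjointness, at most one of the balls contains \<open>q\<close>\<close>
  have K_one: "(\<Sum>p\<in>A. indicator (K p) q) \<le> (1::ennreal)" for q
  proof (cases "\<exists>p\<in>A. q \<in> K p")
    case True
    then obtain p where p: "p \<in> A" "q \<in> K p" by blast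
    have "(\<Sum>p\<in>A. indicator (K p) q :: ennreal) = (\<Sum>p'\<in>A. if p' = p then 1 else 0)"
      using p K_disj by (intro sum.cong) (auto simp: disjoint_family_on_def indicator_def)
    then show ?thesis using A(1) p by simp
  qed (simp add: indicator_def)
  define V where "V p x = (\<integral>\<^sup>+q. ennreal \<bar>kern \<kappa> q x - kern \<kappa> p x\<bar> * indicator (K p) q \<partial>P)" for p x
  define E where "E x = (\<Sum>p\<in>A. ennreal \<delta> * ennreal (kern \<kappa> p x) + V p x)" for x
  have pair: "(\<lambda>z. ennreal \<bar>kern \<kappa> (fst z) (snd z) - kern \<kappa> p (snd z)\<bar> * indicator (K p) (fst z))
      \<in> borel_measurable (borel \<Otimes>\<^sub>M borel)" for p
    by measurable
  have V_meas [measurable]: "V p \<in> borel_measurable borel" for p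
  proof -
    have "(\<lambda>z. ennreal \<bar>kern \<kappa> (fst z) (snd z) - kern \<kappa> p (snd z)\<bar> * indicator (K p) (fst z))
      \<in> borel_measurable (P \<Otimes>\<^sub>M borel)"
      by (rule measurable_prob_measures_pair[OF P pair])
    from measurable_compose[OF measurable_pair_swap' this]
    show ?thesis
      unfolding V_def by (intro P.borel_measurable_nn_integral) (simp add: case_prod_unfold)
  qed
  have bound: "ennreal (\<Sum>p\<in>A. w p * kern \<kappa> p x) \<le> mixture_nn P x + E x" for x
  proof -
    have "ennreal (\<Sum>p\<in>A. w p * kern \<kappa> p x) \<le> (\<Sum>p\<in>A. ennreal (w p * kern \<kappa> p x))"
    proof -
      have "ennreal (\<Sum>p\<in>A. w p * kern \<kappa> p x) \<le> ennreal (\<Sum>p\<in>A. max 0 (w p * kern \<kappa> p x))"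
        by (intro ennreal_leI sum_mono) simp
      also have "\<dots> = (\<Sum>p\<in>A. ennreal (max 0 (w p * kern \<kappa> p x)))"
        by (rule sum_ennreal[symmetric]) simp
      also have "\<dots> = (\<Sum>p\<in>A. ennreal (w p * kern \<kappa> p x))"
        by (intro sum.cong refl) (simp add: max_def ennreal_neg)
      finally show ?thesis .
    qed
    also have "\<dots> \<le> (\<Sum>p\<in>A. (ennreal \<delta> * ennreal (kern \<kappa> p x) + V p x) + (\<integral>\<^sup>+q. ennreal (kern \<kappa> q x) * indicator (K p) q \<partial>P))"
    proof (rule sum_mono)
      fix p assume p: "p \<in> A"
      have k: "0 < kern \<kappa> p x" using p A(2) by (intro kern_pos_loc_scale) auto
      have "w p * kern \<kappa> p x \<le> (measure P (K p) + \<delta>) * kern \<kappa> p x"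
        using w[OF p] k by (intro mult_right_mono) (auto simp: K_def)
      then have "ennreal (w p * kern \<kappa> p x) \<le> ennreal ((measure P (K p) + \<delta>) * kern \<kappa> p x)"
        by (rule ennreal_leI)
      also have "\<dots> = ennreal \<delta> * ennreal (kern \<kappa> p x) + ennreal (kern \<kappa> p x) * emeasure P (K p)"
        using \<delta> k by (simp add: P.emeasure_eq_measure algebra_simps ennreal_mult)
      also have "ennreal (kern \<kappa> p x) * emeasure P (K p) = (\<integral>\<^sup>+q. ennreal (kern \<kappa> p x) * indicator (K p) q \<partial>P)"
        using K_sets by (rule nn_integral_cmult_indicator[symmetric])
      also have "\<dots> \<le> (\<integral>\<^sup>+q. ennreal \<bar>kern \<kappa> q x - kern \<kappa> p x\<bar> * indicator (K p) q + ennreal (kern \<kappa> q x) * indicator (K p) q \<partial>P)"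
      proof (rule nn_integral_mono)
        fix q assume "q \<in> space P"
        then have "0 < kern \<kappa> q x"
          using prob_measures_space[OF P] by (intro kern_pos_loc_scale) auto
        moreover have "ennreal (kern \<kappa> p x) \<le> ennreal (\<bar>kern \<kappa> q x - kern \<kappa> p x\<bar> + kern \<kappa> q x)"
          by (intro ennreal_leI) linarith
        ultimately have "ennreal (kern \<kappa> p x) \<le> ennreal \<bar>kern \<kappa> q x - kern \<kappa> p x\<bar> + ennreal (kern \<kappa> q x)"
          by (simp add: ennreal_plus)
        then show "ennreal (kern \<kappa> p x) * indicator (K p) q
            \<le> ennreal \<bar>kern \<kappa> q x - kern \<kappa> p x\<bar> * indicator (K p) q + ennreal (kern \<kappa> q x) * indicator (K p) q"
          by (cases "q \<in> K p") auto
      qed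
      also have "\<dots> = V p x + (\<integral>\<^sup>+q. ennreal (kern \<kappa> q x) * indicator (K p) q \<partial>P)"
        unfolding V_def by (rule nn_integral_add; rule meas_P; measurable)
      finally show "ennreal (w p * kern \<kappa> p x)
          \<le> (ennreal \<delta> * ennreal (kern \<kappa> p x) + V p x) + (\<integral>\<^sup>+q. ennreal (kern \<kappa> q x) * indicator (K p) q \<partial>P)"
        by (simp add: add.assoc)
    qed
    also have "\<dots> = E x + (\<Sum>p\<in>A. \<integral>\<^sup>+q. ennreal (kern \<kappa> q x) * indicator (K p) q \<partial>P)"
      by (simp add: E_def sum.distrib)
    also have "(\<Sum>p\<in>A. \<integral>\<^sup>+q. ennreal (kern \<kappa> q x) * indicator (K p) q \<partial>P)
        = (\<integral>\<^sup>+q. (\<Sum>p\<in>A. ennreal (kern \<kappa> q x) * indicator (K p) q) \<partial>P)"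
      by (rule nn_integral_sum[symmetric]) (rule meas_P, measurable)
    also have "\<dots> \<le> mixture_nn P x"
      unfolding mixture_nn_def sum_distrib_left[symmetric]
      using mult_left_mono[OF K_one] by (intro nn_integral_mono) fastforce
    finally show ?thesis by (simp add: add.commute add_mono)
  qed
  have "(\<integral>\<^sup>+x. ennreal ((\<Sum>p\<in>A. w p * kern \<kappa> p x) - mixture_density \<kappa> P x) \<partial>lborel) \<le> (\<integral>\<^sup>+x. E x \<partial>lborel)"
  proof (rule nn_integral_mono_AE, use AE_mixture_nn_finite[OF P] in eventually_elim)
    case (elim x)
    then show ?case
      using bound[of x] by (intro ennreal_diff_le mixture_density_nonneg P) simp
  qed
  also have "\<dots> = (\<Sum>p\<in>A. \<integral>\<^sup>+x. (ennreal \<delta> * ennreal (kern \<kappa> p x) + V p x) \<partial>lborel)"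
    unfolding E_def by (rule nn_integral_sum) measurable
  also have "\<dots> \<le> (\<Sum>p\<in>A. ennreal \<delta> + ennreal \<tau> * emeasure P (K p))"
  proof (rule sum_mono)
    fix p assume p: "p \<in> A"
    have "(\<integral>\<^sup>+x. V p x \<partial>lborel)
        = (\<integral>\<^sup>+q. \<integral>\<^sup>+x. ennreal \<bar>kern \<kappa> q x - kern \<kappa> p x\<bar> * indicator (K p) q \<partial>lborel \<partial>P)"
      using nn_integral_mixture_swap[OF P pair[of p]] by (simp add: V_def)
    also have "\<dots> \<le> (\<integral>\<^sup>+q. ennreal \<tau> * indicator (K p) q \<partial>P)"
    proof (rule nn_integral_mono)
      fix q
      have "(\<integral>\<^sup>+x. ennreal \<bar>kern \<kappa> q x - kern \<kappa> p x\<bar> * indicator (K p) q \<partial>lborel)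
          = L1_dist (kern \<kappa> q) (kern \<kappa> p) * indicator (K p) q"
        unfolding L1_dist_def by (rule nn_integral_multc) measurable
      also have "\<dots> \<le> ennreal \<tau> * indicator (K p) q"
        using close[OF p, of q] by (cases "q \<in> K p") (auto simp: K_def)
      finally show "(\<integral>\<^sup>+x. ennreal \<bar>kern \<kappa> q x - kern \<kappa> p x\<bar> * indicator (K p) q \<partial>lborel) \<le> ennreal \<tau> * indicator (K p) q" .
    qed
    also have "\<dots> = ennreal \<tau> * emeasure P (K p)"
      using K_sets by (rule nn_integral_cmult_indicator)
    finally have V: "(\<integral>\<^sup>+x. V p x \<partial>lborel) \<le> ennreal \<tau> * emeasure P (K p)" .
    have "0 < snd p"
      using p A(2) by (auto simp: loc_scale_def)
    then have "(\<integral>\<^sup>+x. (ennreal \<delta> * ennreal (kern \<kappa> p x) + V p x) \<partial>lborel) = ennreal \<delta> + (\<integral>\<^sup>+x. V p x \<partial>lborel)"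
      by (subst nn_integral_add) (auto simp: nn_integral_cmult nn_integral_kern)
    with V show "(\<integral>\<^sup>+x. (ennreal \<delta> * ennreal (kern \<kappa> p x) + V p x) \<partial>lborel) \<le> ennreal \<delta> + ennreal \<tau> * emeasure P (K p)"
      by (simp add: add_left_mono)
  qed
  also have "\<dots> = ennreal (real (card A) * \<delta>) + ennreal \<tau> * emeasure P (\<Union>p\<in>A. K p)"
  proof -
    have "(\<Sum>p\<in>A. emeasure P (K p)) = emeasure P (\<Union>p\<in>A. K p)"
      using K_sets K_disj A(1) by (intro sum_emeasure) auto
    then show ?thesis
      using \<delta>(1)
      by (simp add: sum.distrib sum_distrib_left[symmetric] ennreal_mult ennreal_of_nat_eq_real_of_nat)
  qed
  also have "\<dots> \<le> ennreal \<tau> + ennreal \<tau> * 1"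
    using \<delta>(2) P.emeasure_le_1 by (intro add_mono ennreal_leI mult_left_mono) auto
  also have "\<dots> = ennreal (2 * \<tau>)"
    using \<open>0 \<le> \<tau>\<close> by (simp flip: ennreal_plus)
  finally show ?thesis .
qed

end

section \<open>The logarithmic ratio of a density and a mixture\<close>

text \<open>Jensen's inequality for the normalised restriction of the measure to \<open>K\<close>. With \<open>m = \<integral>\<^sub>K u\<close> and
  \<open>\<pi> = prob K\<close> it follows by integrating \<open>ln u \<le> ln (m / \<pi>) + \<pi> u / m - 1\<close> over \<open>K\<close>. The first
  two claims make the integrals in the last two meaningful.\<close>

lemma (in prob_space) minus_ln_integral_le:
  assumes K: "K \<in> sets M" and [measurable]: "u \<in> borel_measurable M"
    and u: "\<And>q. q \<in> K \<Longrightarrow> c \<le> u q" "\<And>q. q \<in> K \<Longrightarrow> u q \<le> C" and "0 < c"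
    and \<gamma>: "0 < \<gamma>" "\<gamma> \<le> prob K"
  shows "integrable M (\<lambda>q. indicator K q * u q)"
    and "integrable M (\<lambda>q. indicator K q * \<bar>ln (u q)\<bar>)"
    and "c * \<gamma> \<le> (\<integral>q. indicator K q * u q \<partial>M)"
    and "- ln (\<integral>q. indicator K q * u q \<partial>M) \<le> \<bar>ln \<gamma>\<bar> + 1 / \<gamma> * (\<integral>q. indicator K q * \<bar>ln (u q)\<bar> \<partial>M)"
proof -
  note [measurable] = K
  define \<pi> where "\<pi> = prob K"
  have \<pi>: "0 < \<pi>" "\<gamma> \<le> \<pi>" using \<gamma> by (auto simp: \<pi>_def)
  let ?L = "\<bar>ln c\<bar> + \<bar>ln C\<bar>"
  have u_pos: "0 < u q" if "q \<in> K" for q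
    using u(1)[OF that] \<open>0 < c\<close> by simp
  have abs_bd: "\<bar>u q\<bar> \<le> \<bar>C\<bar>" if "q \<in> K" for q
    using u(2)[OF that] u_pos[OF that] by linarith
  have ln_bd: "\<bar>ln (u q)\<bar> \<le> ?L" if "q \<in> K" for q
  proof -
    have "ln c \<le> ln (u q)" "ln (u q) \<le> ln C"
      using u[OF that] \<open>0 < c\<close> u_pos[OF that] by (auto intro!: ln_mono)
    then show ?thesis by linarith
  qed
  show int_u: "integrable M (\<lambda>q. indicator K q * u q)"
    by (rule integrable_const_bound[where B="\<bar>C\<bar>"])
       (auto simp: indicator_def abs_bd intro!: AE_I2)
  show int_ln_abs: "integrable M (\<lambda>q. indicator K q * \<bar>ln (u q)\<bar>)"
    by (rule integrable_const_bound[where B="?L"]) (auto simp: indicator_def ln_bd intro!: AE_I2)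
  have int_ln: "integrable M (\<lambda>q. indicator K q * ln (u q))"
    by (rule integrable_const_bound[where B="?L"]) (auto simp: indicator_def ln_bd intro!: AE_I2)
  have int_K: "integrable M (indicat_real K)"
    by (rule integrable_const_bound[where B=1]) (auto simp: indicator_def)
  define m where "m = (\<integral>q. indicator K q * u q \<partial>M)"
  have "c * \<gamma> \<le> c * \<pi>"
    using \<pi> \<open>0 < c\<close> by simp
  also have "\<dots> = (\<integral>q. indicator K q * c \<partial>M)"
    using K by (simp add: \<pi>_def)
  also have "\<dots> \<le> m"
    unfolding m_def
  proof (rule integral_mono)
    show "integrable M (\<lambda>q. indicator K q * c)"
      using int_K by simp
    show "indicator K q * c \<le> indicator K q * u q" for q
      using u(1) by (cases "q \<in> K") simp_all
  qed (rule int_u)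
  finally show "c * \<gamma> \<le> (\<integral>q. indicator K q * u q \<partial>M)"
    by (simp add: m_def)
  then have m: "0 < m"
    using \<open>0 < c\<close> \<gamma>(1) by (simp add: m_def) (meson less_le_trans mult_pos_pos)
  have "(\<integral>q. indicator K q * ln (u q) \<partial>M)
      \<le> (\<integral>q. indicator K q * (ln (m / \<pi>) - 1) + \<pi> / m * (indicator K q * u q) \<partial>M)"
  proof (rule integral_mono)
    show "integrable M (\<lambda>q. indicator K q * (ln (m / \<pi>) - 1) + \<pi> / m * (indicator K q * u q))"
      using int_K int_u by auto
    fix q
    show "indicator K q * ln (u q) \<le> indicator K q * (ln (m / \<pi>) - 1) + \<pi> / m * (indicator K q * u q)"
    proof (cases "q \<in> K")
      case True
      have "ln (u q) = ln (m / \<pi>) + ln (\<pi> / m * u q)"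
        using m \<pi> u_pos[OF True] by (subst ln_mult_pos[symmetric]) auto
      also have "ln (\<pi> / m * u q) \<le> \<pi> / m * u q - 1"
        using m \<pi> u_pos[OF True] by (intro ln_le_minus_one) auto
      finally show ?thesis using True by simp
    qed simp
  qed (rule int_ln)
  also have "\<dots> = \<pi> * (ln (m / \<pi>) - 1) + \<pi> / m * m"
    using int_K int_u K by (simp add: m_def \<pi>_def)
  also have "\<dots> = \<pi> * (ln m - ln \<pi>)"
    using m \<pi> by (simp add: ln_div field_simps)
  finally have jensen: "(\<integral>q. indicator K q * ln (u q) \<partial>M) \<le> \<pi> * (ln m - ln \<pi>)" .
  define J where "J = (\<integral>q. indicator K q * \<bar>ln (u q)\<bar> \<partial>M)"
  have "0 \<le> J"
    unfolding J_def by (intro integral_nonneg_AE AE_I2) simp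
  have "- J \<le> (\<integral>q. indicator K q * ln (u q) \<partial>M)"
    unfolding J_def integral_minus[symmetric] using int_ln int_ln_abs
    by (intro integral_mono) (auto simp: indicator_def)
  with jensen have "- J / \<pi> \<le> ln m - ln \<pi>"
    using \<pi> by (simp add: field_simps)
  then have "- ln m \<le> - ln \<pi> + J / \<pi>" by simp
  also have "- ln \<pi> \<le> \<bar>ln \<gamma>\<bar>"
    using \<pi> \<gamma> ln_mono[of \<gamma> \<pi>] by linarith
  also have "J / \<pi> \<le> 1 / \<gamma> * J"
    using \<pi> \<gamma> \<open>0 \<le> J\<close> by (simp add: frac_le)
  finally show "- ln (\<integral>q. indicator K q * u q \<partial>M) \<le> \<bar>ln \<gamma>\<bar> + 1 / \<gamma> * (\<integral>q. indicator K q * \<bar>ln (u q)\<bar> \<partial>M)"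
    by (simp add: m_def J_def)
qed

context positive_kernel
begin

text \<open>Inside the ball of radius \<open>R\<close> the part of \<open>P\<close> on \<open>K\<close> keeps the mixture above \<open>c * \<gamma>\<close>, and
  \<open>ln y \<le> y - 1\<close> applied to \<open>y = b * f x / mixture_density \<kappa> P x\<close> gives the first two terms.
  Outside it, Jensen's inequality on \<open>K\<close> gives the other three. The negative part of the integrand
  is dropped.\<close>

lemma log_ratio_integral_mixture_le:
  assumes P: "P \<in> prob_measures loc_scale"
    and [measurable]: "f \<in> borel_measurable borel" and f: "\<And>x. 0 < f x" "\<And>x. f x \<le> M"
    and K: "compact K" "K \<subseteq> loc_scale" and \<gamma>: "0 < \<gamma>" "\<gamma> \<le> measure P K"
    and c: "0 < c" "\<And>q x. q \<in> K \<Longrightarrow> x \<in> cball 0 (real R) \<Longrightarrow> c \<le> kern \<kappa> q x"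
    and b: "0 < b" "b \<le> 1"
  shows "log_ratio_integral f (mixture_density \<kappa> P) \<le> enn2ereal (
      ennreal (- ln b) * (\<integral>\<^sup>+x. ennreal (f x) \<partial>lborel)
    + ennreal (M / (c * \<gamma>)) * (\<integral>\<^sup>+x. ennreal (b * f x - mixture_density \<kappa> P x) \<partial>lborel)
    + (\<integral>\<^sup>+x. ennreal \<bar>f x * ln (f x)\<bar> * indicator (- cball 0 (real R)) x \<partial>lborel)
    + ennreal \<bar>ln \<gamma>\<bar> * (\<integral>\<^sup>+x. ennreal \<bar>f x\<bar> * indicator (- cball 0 (real R)) x \<partial>lborel)
    + ennreal (1 / \<gamma>) * (\<integral>\<^sup>+q. log_tail f R q * indicator K q \<partial>P))"
proof -
  interpret P: prob_space P using P by (simp add: prob_measures_iff)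
  let ?g = "mixture_density \<kappa> P"
  let ?out = "indicator (- cball 0 (real R)) :: real ^ 'n \<Rightarrow> ennreal"
  note [measurable] = mixture_density_measurable[OF P]
  have cball_borel [measurable]: "cball (0::real^'n) s \<in> sets borel" for s
    by simp
  have K_borel [measurable]: "K \<in> sets borel"
    using K(1) by (intro borel_closed compact_imp_closed)
  have K_sets: "K \<in> sets P"
    using P K_borel K(2) by (rule borel_sets_prob_measures)
  have "K \<noteq> {}" using \<gamma> by auto
  have M: "0 < M" using f[of 0] by simp
  have kern_bounds: "\<exists>c' C'. 0 < c' \<and> (\<forall>q\<in>K. c' \<le> kern \<kappa> q x \<and> kern \<kappa> q x \<le> C')" for x
  proof -
    have "continuous_on K (\<lambda>q. (q, x))" "(\<lambda>q. (q, x)) ` K \<subseteq> loc_scale \<times> UNIV"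
      using K(2) by (auto intro!: continuous_intros)
    from continuous_on_compose2[OF kern_continuous_on this]
    have "continuous_on K (\<lambda>q. kern \<kappa> q x)"
      by simp
    then obtain q1 q2 where "q1 \<in> K" "\<forall>q\<in>K. kern \<kappa> q1 x \<le> kern \<kappa> q x" "\<forall>q\<in>K. kern \<kappa> q x \<le> kern \<kappa> q2 x"
      using continuous_attains_inf[OF K(1) \<open>K \<noteq> {}\<close>] continuous_attains_sup[OF K(1) \<open>K \<noteq> {}\<close>] by metis
    then show ?thesis
      using kern_pos_loc_scale[of q1 x] K(2) by blast
  qed
  have kern_P: "(\<lambda>q. kern \<kappa> q x) \<in> borel_measurable P" for x
    by (rule measurable_prob_measures[OF P]) measurable
  define m where "m x = (\<integral>q. indicator K q * kern \<kappa> q x \<partial>P)" for x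
  define T where "T x = (\<integral>\<^sup>+q. ennreal (f x * \<bar>ln (kern \<kappa> q x)\<bar>) * ?out x * indicator K q \<partial>P)" for x
  define B where "B x = ennreal (- ln b) * ennreal (f x) + ennreal (M / (c * \<gamma>)) * ennreal (b * f x - ?g x)
      + ennreal \<bar>f x * ln (f x)\<bar> * ?out x + ennreal \<bar>ln \<gamma>\<bar> * (ennreal \<bar>f x\<bar> * ?out x) + ennreal (1 / \<gamma>) * T x" for x
  let ?F = "\<lambda>x. if f x = 0 then 0 else if ?g x = 0 then \<infinity> else ereal (f x * ln (f x / ?g x))"
  have pointwise: "e2ennreal (?F x) \<le> B x" if fin: "mixture_nn P x = ennreal (?g x)" for x
  proof -
    obtain c' C' where c': "0 < c'" "\<And>q. q \<in> K \<Longrightarrow> c' \<le> kern \<kappa> q x" "\<And>q. q \<in> K \<Longrightarrow> kern \<kappa> q x \<le> C'"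
      using kern_bounds by blast
    note J = P.minus_ln_integral_le[OF K_sets kern_P c'(2,3,1) \<gamma>]
    have "ennreal (m x) = (\<integral>\<^sup>+q. ennreal (indicator K q * kern \<kappa> q x) \<partial>P)"
      unfolding m_def using K(2) J(1)
      by (intro nn_integral_eq_integral[symmetric] AE_I2) (auto simp: indicator_def intro: less_imp_le kern_pos_loc_scale)
    also have "\<dots> \<le> mixture_nn P x"
      unfolding mixture_nn_def by (intro nn_integral_mono) (auto simp: indicator_def)
    finally have m_le: "m x \<le> ?g x"
      using fin mixture_density_nonneg[OF P] by simp
    have m_pos: "0 < m x"
      using J(3) c'(1) \<gamma>(1) unfolding m_def by (meson less_le_trans mult_pos_pos)
    have g_pos: "0 < ?g x" using m_le m_pos by simp
    have F: "e2ennreal (?F x) = ennreal (f x * ln (f x / ?g x))"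
      using g_pos f(1)[of x] by simp
    show ?thesis
    proof (cases "x \<in> cball 0 (real R)")
      case True
      have "c * \<gamma> \<le> m x"
        unfolding m_def using P.minus_ln_integral_le(3)[OF K_sets kern_P c(2) c'(3) c(1) \<gamma>] True by blast
      then have cg: "c * \<gamma> \<le> ?g x" "0 < c * \<gamma>" using m_le c(1) \<gamma>(1) by auto
      have "ln (f x / ?g x) = - ln b + ln (b * f x / ?g x)"
        using f(1)[of x] g_pos b by (simp add: ln_div ln_mult_pos)
      also have "ln (b * f x / ?g x) \<le> b * f x / ?g x - 1"
        using f(1)[of x] g_pos b by (intro ln_le_minus_one) auto
      also have "b * f x / ?g x - 1 = (b * f x - ?g x) / ?g x"
        using g_pos by (simp add: field_simps)
      also have "\<dots> \<le> max 0 (b * f x - ?g x) / ?g x"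
        using g_pos by (intro divide_right_mono) auto
      also have "\<dots> \<le> max 0 (b * f x - ?g x) / (c * \<gamma>)"
        using cg by (intro divide_left_mono) auto
      finally have "f x * ln (f x / ?g x) \<le> f x * (- ln b + max 0 (b * f x - ?g x) / (c * \<gamma>))"
        using f(1)[of x] by (intro mult_left_mono) auto
      also have "\<dots> \<le> - ln b * f x + M / (c * \<gamma>) * max 0 (b * f x - ?g x)"
        using f(2)[of x] cg(2) mult_right_mono[of "f x" M "max 0 (b * f x - ?g x) / (c * \<gamma>)"]
        by (simp add: algebra_simps)
      finally have "ennreal (f x * ln (f x / ?g x)) \<le> ennreal (- ln b * f x + M / (c * \<gamma>) * max 0 (b * f x - ?g x))"
        by (rule ennreal_leI)
      also have "\<dots> = ennreal (- ln b) * ennreal (f x) + ennreal (M / (c * \<gamma>)) * ennreal (max 0 (b * f x - ?g x))"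
      proof -
        have "ennreal (s * t + u * v) = ennreal s * ennreal t + ennreal u * ennreal v"
          if "0 \<le> s" "0 \<le> t" "0 \<le> u" "0 \<le> v" for s t u v :: real
          using that by (simp add: ennreal_mult)
        moreover have "0 \<le> - ln b" "0 \<le> f x" "0 \<le> M / (c * \<gamma>)"
          using b f(1)[of x] M cg(2) by auto
        ultimately show ?thesis by (metis max.cobounded1)
      qed
      also have "ennreal (max 0 (b * f x - ?g x)) = ennreal (b * f x - ?g x)"
        by (simp add: max_def ennreal_neg)
      also have "ennreal (- ln b) * ennreal (f x) + ennreal (M / (c * \<gamma>)) * ennreal (b * f x - ?g x) \<le> B x"
        unfolding B_def by (simp add: add.assoc)
      finally show ?thesis unfolding F .
    next
      case False
      then have out: "?out x = 1" by simp
      define I where "I = (\<integral>q. indicator K q * \<bar>ln (kern \<kappa> q x)\<bar> \<partial>P)"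
      have I: "0 \<le> I" unfolding I_def by (intro integral_nonneg_AE AE_I2) simp
      have "ln (m x) \<le> ln (?g x)"
        using m_le m_pos g_pos by simp
      then have "ln (f x / ?g x) \<le> ln (f x) - ln (m x)"
        using f(1)[of x] g_pos by (simp add: ln_div)
      also have "\<dots> \<le> \<bar>ln (f x)\<bar> + (\<bar>ln \<gamma>\<bar> + 1 / \<gamma> * I)"
        using J(4) unfolding m_def I_def by linarith
      finally have "f x * ln (f x / ?g x) \<le> f x * (\<bar>ln (f x)\<bar> + (\<bar>ln \<gamma>\<bar> + 1 / \<gamma> * I))"
        using f(1)[of x] by (intro mult_left_mono) auto
      also have "\<dots> = \<bar>f x * ln (f x)\<bar> + (\<bar>ln \<gamma>\<bar> * \<bar>f x\<bar> + 1 / \<gamma> * (f x * I))"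
        using f(1)[of x] by (simp add: abs_mult algebra_simps)
      finally have "ennreal (f x * ln (f x / ?g x)) \<le> ennreal (\<bar>f x * ln (f x)\<bar> + (\<bar>ln \<gamma>\<bar> * \<bar>f x\<bar> + 1 / \<gamma> * (f x * I)))"
        by (rule ennreal_leI)
      also have "\<dots> = ennreal \<bar>f x * ln (f x)\<bar> + (ennreal \<bar>ln \<gamma>\<bar> * ennreal \<bar>f x\<bar> + ennreal (1 / \<gamma>) * ennreal (f x * I))"
      proof -
        have "ennreal (s + (t * u + v * w)) = ennreal s + (ennreal t * ennreal u + ennreal v * ennreal w)"
          if "0 \<le> s" "0 \<le> t" "0 \<le> u" "0 \<le> v" "0 \<le> w" for s t u v w :: real
          using that by (simp add: ennreal_mult)
        moreover have "0 \<le> f x * I" "0 \<le> 1 / \<gamma>"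
          using f(1)[of x] I \<gamma>(1) by auto
        ultimately show ?thesis by (metis abs_ge_zero)
      qed
      also have "ennreal (f x * I) = T x"
      proof -
        have "ennreal (f x * I) = ennreal (\<integral>q. f x * (indicator K q * \<bar>ln (kern \<kappa> q x)\<bar>) \<partial>P)"
          by (simp add: I_def)
        also have "\<dots> = (\<integral>\<^sup>+q. ennreal (f x * (indicator K q * \<bar>ln (kern \<kappa> q x)\<bar>)) \<partial>P)"
          using J(2) f(1)[of x] by (intro nn_integral_eq_integral[symmetric] AE_I2) auto
        also have "\<dots> = T x"
          unfolding T_def out by (intro nn_integral_cong) (auto simp: indicator_def)
        finally show ?thesis .
      qed
      also have "ennreal \<bar>f x * ln (f x)\<bar> + (ennreal \<bar>ln \<gamma>\<bar> * ennreal \<bar>f x\<bar> + ennreal (1 / \<gamma>) * T x) \<le> B x"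
        unfolding B_def out by (simp add: add.assoc add_increasing)
      finally show ?thesis unfolding F .
    qed
  qed
  have pair: "(\<lambda>z. ennreal (f (snd z) * \<bar>ln (kern \<kappa> (fst z) (snd z))\<bar>) * ?out (snd z) * indicator K (fst z))
      \<in> borel_measurable (borel \<Otimes>\<^sub>M borel)"
    by measurable
  have T_meas [measurable]: "T \<in> borel_measurable borel"
  proof -
    have "(\<lambda>z. ennreal (f (snd z) * \<bar>ln (kern \<kappa> (fst z) (snd z))\<bar>) * ?out (snd z) * indicator K (fst z))
      \<in> borel_measurable (P \<Otimes>\<^sub>M borel)"
      by (rule measurable_prob_measures_pair[OF P pair])
    from measurable_compose[OF measurable_pair_swap' this]
    show ?thesis
      unfolding T_def by (intro P.borel_measurable_nn_integral) (simp add: case_prod_unfold)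
  qed
  have T_int: "(\<integral>\<^sup>+x. T x \<partial>lborel) = (\<integral>\<^sup>+q. log_tail f R q * indicator K q \<partial>P)"
  proof -
    have "(\<integral>\<^sup>+x. T x \<partial>lborel)
        = (\<integral>\<^sup>+q. \<integral>\<^sup>+x. ennreal (f x * \<bar>ln (kern \<kappa> q x)\<bar>) * ?out x * indicator K q \<partial>lborel \<partial>P)"
      using nn_integral_mixture_swap[OF P pair] by (simp add: T_def)
    also have "\<dots> = (\<integral>\<^sup>+q. log_tail f R q * indicator K q \<partial>P)"
      unfolding log_tail_def by (intro nn_integral_cong nn_integral_multc) measurable
    finally show ?thesis .
  qed
  have "log_ratio_integral f ?g \<le> enn2ereal (\<integral>\<^sup>+x. e2ennreal (?F x) \<partial>lborel)"
    unfolding log_ratio_integral_def ext_integral_def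
    by (rule ereal_diff_le_self) simp
  also have "\<dots> \<le> enn2ereal (\<integral>\<^sup>+x. B x \<partial>lborel)"
  proof -
    have "(\<integral>\<^sup>+x. e2ennreal (?F x) \<partial>lborel) \<le> (\<integral>\<^sup>+x. B x \<partial>lborel)"
    proof (rule nn_integral_mono_AE, use AE_mixture_nn_finite[OF P] in eventually_elim)
      case (elim x)
      then show ?case by (rule pointwise)
    qed
    then show ?thesis by (simp add: less_eq_ennreal.rep_eq)
  qed
  also have "(\<integral>\<^sup>+x. B x \<partial>lborel) =
      ennreal (- ln b) * (\<integral>\<^sup>+x. ennreal (f x) \<partial>lborel)
    + ennreal (M / (c * \<gamma>)) * (\<integral>\<^sup>+x. ennreal (b * f x - ?g x) \<partial>lborel)
    + (\<integral>\<^sup>+x. ennreal \<bar>f x * ln (f x)\<bar> * ?out x \<partial>lborel)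
    + ennreal \<bar>ln \<gamma>\<bar> * (\<integral>\<^sup>+x. ennreal \<bar>f x\<bar> * ?out x \<partial>lborel)
    + ennreal (1 / \<gamma>) * (\<integral>\<^sup>+q. log_tail f R q * indicator K q \<partial>P)"
    unfolding B_def T_int[symmetric] by (simp add: nn_integral_add nn_integral_cmult)
  finally show ?thesis .
qed

end

section \<open>The Kullback-Leibler property\<close>

context positive_kernel
begin

text \<open>The order of the choices matters: the factor \<open>b\<close> fixes the mass available for the extra atom, this
  mass fixes the accuracy needed in the tail and hence the ball \<open>K\<close> and the radius \<open>R\<close>, and only
  the lower bound \<open>c\<close> that these give determines how accurate the finite mixture in the bulk has to
  be. The two parts of the neighbourhood are used in separate bounds, so the balls of the bulk may
  overlap \<open>K\<close>.\<close>

lemma small_log_ratio_weak_neighbourhood: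
  assumes f_meas [measurable]: "f \<in> borel_measurable borel" and f: "\<And>x. 0 < f x" "\<And>x. f x \<le> M"
    and f1: "(\<integral>\<^sup>+x. ennreal (f x) \<partial>lborel) = 1"
    and entropy: "integrable lborel (\<lambda>x. f x * ln (f x))"
    and log_int: "\<And>a b. 0 < b \<Longrightarrow> integrable lborel (\<lambda>x. f x * \<bar>ln (\<kappa> ((x - a) /\<^sub>R b))\<bar>)"
    and "0 < \<epsilon>"
  shows "\<exists>U P0. openin (weak_topology loc_scale) U \<and> P0 \<in> U \<and>
           (\<forall>P\<in>U. log_ratio_integral f (mixture_density \<kappa> P) < ereal \<epsilon>)"
proof -
  have M: "0 < M" using f[of 0] by simp
  have f_int: "integrable lborel f"
    using f(1) f1 by (intro integrableI_nonneg) (auto intro: less_imp_le)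
  \<comment> \<open>so that the factor \<open>b\<close> costs exactly \<open>\<epsilon> / 4\<close>\<close>
  define b where "b = exp (- \<epsilon> / 4)"
  define \<alpha> where "\<alpha> = 1 - b"
  \<comment> \<open>the extra atom will have mass at least \<open>\<alpha> / 2\<close>, so \<open>\<gamma>\<close> is strictly below it\<close>
  define \<gamma> where "\<gamma> = \<alpha> / 4"
  have b: "0 < b" "b < 1" "- ln b = \<epsilon> / 4" using \<open>0 < \<epsilon>\<close> by (auto simp: b_def)
  have \<alpha>: "0 < \<alpha>" "\<alpha> < 1" using b by (auto simp: \<alpha>_def)
  have \<gamma>: "0 < \<gamma>" using \<alpha> by (simp add: \<gamma>_def)
  have "0 < \<gamma> * \<epsilon> / 8"
    using \<gamma> \<open>0 < \<epsilon>\<close> by simp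
  then obtain p r R0 where pr: "0 < r" "cball p r \<subseteq> loc_scale" "\<And>q. q \<in> cball p r \<Longrightarrow> log_tail f R0 q \<le> ennreal (\<gamma> * \<epsilon> / 8)"
    using log_tail_uniformly_small[OF f_int less_imp_le[OF f(1)] log_int] by blast
  let ?tail = "\<lambda>g R. \<integral>\<^sup>+x. ennreal \<bar>g x\<bar> * indicator (- cball 0 (real R)) x \<partial>(lborel :: (real ^ 'n) measure)"
  obtain R1 where R1: "\<And>R. R1 \<le> R \<Longrightarrow> ?tail (\<lambda>x. f x * ln (f x)) R \<le> ennreal (\<epsilon> / 8)"
  proof -
    have "(\<integral>\<^sup>+x. ennreal \<bar>f x * ln (f x)\<bar> \<partial>lborel) < \<infinity>"
      using entropy by (simp add: integrable_iff_bounded)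
    then show thesis
      using L1_tail_small[of "\<lambda>x. f x * ln (f x)" "\<epsilon> / 8"] \<open>0 < \<epsilon>\<close> that by auto
  qed
  obtain R2 where R2: "\<And>R. R2 \<le> R \<Longrightarrow> ?tail f R \<le> ennreal (\<epsilon> / (8 * (\<bar>ln \<gamma>\<bar> + 1)))"
  proof -
    have "(\<integral>\<^sup>+x. ennreal \<bar>f x\<bar> \<partial>lborel) < \<infinity>"
      using f_int by (simp add: integrable_iff_bounded)
    moreover have "0 < \<epsilon> / (8 * (\<bar>ln \<gamma>\<bar> + 1))"
      using \<open>0 < \<epsilon>\<close> by (intro divide_pos_pos) auto
    ultimately show thesis
      using L1_tail_small[OF f_meas] that by blast
  qed
  define R where "R = max R0 (max R1 R2)"
  define K where "K = cball p r"
  have K: "compact K" "K \<subseteq> loc_scale" "K \<noteq> {}"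
    using pr by (auto simp: K_def)
  have K_borel: "K \<in> sets borel" by (simp add: K_def)
  obtain c where c: "0 < c" "\<And>q x. q \<in> K \<Longrightarrow> x \<in> cball 0 (real R) \<Longrightarrow> c \<le> kern \<kappa> q x"
  proof -
    have "compact (K \<times> cball (0::real^'n) (real R))" "K \<times> cball (0::real^'n) (real R) \<noteq> {}"
      using K by (auto intro!: compact_Times)
    moreover have "continuous_on (K \<times> cball 0 (real R)) (\<lambda>z. kern \<kappa> (fst z) (snd z))"
      by (rule continuous_on_subset[OF kern_continuous_on]) (use K(2) in auto)
    ultimately obtain z where z: "z \<in> K \<times> cball 0 (real R)"
        "\<forall>y\<in>K \<times> cball 0 (real R). kern \<kappa> (fst z) (snd z) \<le> kern \<kappa> (fst y) (snd y)"
      using continuous_attains_inf by meson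
    show thesis
    proof (rule that[of "kern \<kappa> (fst z) (snd z)"])
      show "0 < kern \<kappa> (fst z) (snd z)"
        using z(1) K(2) by (intro kern_pos_loc_scale) auto
    qed (use z(2) in auto)
  qed
  \<comment> \<open>\<open>\<tau> \<le> \<alpha> / 2\<close> leaves mass \<open>\<alpha> / 2\<close> for the extra atom; the other bound makes the bulk error at most \<open>\<epsilon> / 8\<close>\<close>
  define \<tau> where "\<tau> = min (\<alpha> / 2) (\<epsilon> * c * \<gamma> / (24 * M))"
  have \<tau>: "0 < \<tau>" "\<tau> \<le> \<alpha> / 2" "M / (c * \<gamma>) * (3 * \<tau>) \<le> \<epsilon> / 8"
  proof -
    show "0 < \<tau>" "\<tau> \<le> \<alpha> / 2"
      using \<alpha> \<open>0 < \<epsilon>\<close> c(1) \<gamma> M by (auto simp: \<tau>_def)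
    have "M / (c * \<gamma>) * (3 * \<tau>) \<le> M / (c * \<gamma>) * (3 * (\<epsilon> * c * \<gamma> / (24 * M)))"
      using c(1) \<gamma> M by (intro mult_left_mono) (auto simp: \<tau>_def)
    also have "\<dots> = \<epsilon> / 8"
      using c(1) \<gamma> M by (simp add: field_simps)
    finally show "M / (c * \<gamma>) * (3 * \<tau>) \<le> \<epsilon> / 8" .
  qed
  obtain A w where A: "finite A" "A \<subseteq> loc_scale" and w: "\<And>a. a \<in> A \<Longrightarrow> 0 \<le> w a"
      and s: "L1_dist (\<lambda>x. \<Sum>a\<in>A. w a * kern \<kappa> a x) f \<le> ennreal \<tau>"
    using finite_mixtures_L1_dense[OF f_meas less_imp_le[OF f(1)] f(2) _ \<tau>(1)] f1 by auto
  let ?s = "\<lambda>x. \<Sum>a\<in>A. w a * kern \<kappa> a x"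
  have s_nonneg: "0 \<le> ?s x" for x
    using w A(2) by (intro sum_nonneg mult_nonneg_nonneg less_imp_le[OF kern_pos_loc_scale]) auto
  have "ennreal (sum w A) = (\<integral>\<^sup>+x. ennreal (?s x) \<partial>lborel)"
  proof -
    have "(\<integral>\<^sup>+x. ennreal (?s x) \<partial>lborel) = (\<integral>\<^sup>+x. (\<Sum>a\<in>A. ennreal (w a) * ennreal (kern \<kappa> a x)) \<partial>lborel)"
    proof (rule nn_integral_cong)
      fix x
      have k: "0 \<le> kern \<kappa> a x" if "a \<in> A" for a
        using that A(2) by (intro less_imp_le[OF kern_pos_loc_scale]) auto
      have "ennreal (?s x) = (\<Sum>a\<in>A. ennreal (w a * kern \<kappa> a x))"
        using w k by (intro sum_ennreal[symmetric]) auto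
      also have "\<dots> = (\<Sum>a\<in>A. ennreal (w a) * ennreal (kern \<kappa> a x))"
        using w k by (intro sum.cong ennreal_mult) auto
      finally show "ennreal (?s x) = (\<Sum>a\<in>A. ennreal (w a) * ennreal (kern \<kappa> a x))" .
    qed
    also have "\<dots> = (\<Sum>a\<in>A. ennreal (w a) * (\<integral>\<^sup>+x. ennreal (kern \<kappa> a x) \<partial>lborel))"
      by (subst nn_integral_sum) (auto simp: nn_integral_cmult)
    also have "\<dots> = (\<Sum>a\<in>A. ennreal (w a))"
      using A(2) by (intro sum.cong refl) (auto simp: nn_integral_kern loc_scale_def)
    finally show ?thesis
      using w by (simp add: sum_ennreal)
  qed
  also have "\<dots> \<le> (\<integral>\<^sup>+x. ennreal \<bar>?s x - f x\<bar> + ennreal (f x) \<partial>lborel)"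
  proof (rule nn_integral_mono)
    fix x
    have "ennreal (?s x) \<le> ennreal (\<bar>?s x - f x\<bar> + f x)"
      by (intro ennreal_leI) linarith
    then show "ennreal (?s x) \<le> ennreal \<bar>?s x - f x\<bar> + ennreal (f x)"
      using f(1)[of x] by (simp add: ennreal_plus)
  qed
  also have "\<dots> = L1_dist ?s f + 1"
    unfolding L1_dist_def f1[symmetric] by (rule nn_integral_add) measurable
  also have "\<dots> \<le> ennreal \<tau> + ennreal 1"
    using s by (simp add: add_right_mono)
  also have "\<dots> = ennreal (\<tau> + 1)"
    using \<tau>(1) by (simp add: ennreal_plus)
  finally have w_sum: "sum w A \<le> 1 + \<tau>"
    using \<tau>(1) by (simp add: ennreal_le_iff add.commute del: ennreal_plus)
  have bw_sum: "(\<Sum>a\<in>A. b * w a) \<le> 1 - \<alpha> / 2"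
  proof -
    have "b * sum w A \<le> b * (1 + \<tau>)"
      using b w_sum by (intro mult_left_mono) auto
    also have "\<dots> \<le> b + \<tau>"
      using b \<tau>(1) by (simp add: algebra_simps mult_left_le)
    finally show ?thesis
      using \<tau>(2) unfolding sum_distrib_left \<alpha>_def by (simp add: field_simps)
  qed
  have "p \<in> loc_scale" using pr by auto
  then obtain P0 where P0: "P0 \<in> prob_measures loc_scale"
      "\<And>a. a \<in> A \<Longrightarrow> b * w a \<le> measure P0 {a}" "1 - (\<Sum>a\<in>A. b * w a) \<le> measure P0 {p}"
    using finitely_supported_prob_measure[OF A, of p "\<lambda>a. b * w a"] b w bw_sum \<alpha>(1)
    by (auto simp: mult_nonneg_nonneg)
  \<comment> \<open>slack for each atom, at most \<open>\<tau>\<close> in total; adding \<open>1\<close> covers an empty \<open>A\<close>\<close>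
  define \<delta> where "\<delta> = \<tau> / (real (card A) + 1)"
  have \<delta>: "0 < \<delta>" "real (card A) * \<delta> \<le> \<tau>"
    using \<tau>(1) by (simp_all add: \<delta>_def pos_divide_le_eq distrib_left mult.commute)
  have "\<forall>a\<in>A. \<exists>r>0. \<forall>q. dist q a < r \<longrightarrow> L1_dist (kern \<kappa> q) (kern \<kappa> a) \<le> ennreal \<tau>"
  proof
    fix a assume "a \<in> A"
    then have "0 < snd a"
      using A(2) by (auto simp: loc_scale_def)
    from kern_L1_continuous[OF this \<tau>(1)]
    show "\<exists>r>0. \<forall>q. dist q a < r \<longrightarrow> L1_dist (kern \<kappa> q) (kern \<kappa> a) \<le> ennreal \<tau>"
      by blast
  qed
  then obtain r0 where r0: "\<And>a. a \<in> A \<Longrightarrow> 0 < r0 a"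
      "\<And>a q. a \<in> A \<Longrightarrow> dist q a < r0 a \<Longrightarrow> L1_dist (kern \<kappa> q) (kern \<kappa> a) \<le> ennreal \<tau>"
    by metis
  obtain r' where r': "\<And>a. a \<in> A \<Longrightarrow> 0 < r' a" "\<And>a. a \<in> A \<Longrightarrow> r' a \<le> r0 a"
      "disjoint_family_on (\<lambda>a. ball a (r' a)) A"
    using disjoint_balls_radii[of A r0, OF A(1) r0(1)] by blast
  have slack: "b * w a - \<delta> < measure P0 {a}" if "a \<in> A" for a
    using P0(2)[OF that] \<delta>(1) by linarith
  obtain U1 where U1: "openin (weak_topology loc_scale) U1" "P0 \<in> U1"
      "\<And>P a. P \<in> U1 \<Longrightarrow> a \<in> A \<Longrightarrow> b * w a - \<delta> < measure P (ball a (r' a) \<inter> loc_scale)"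
    using weak_neighbourhood_balls[of P0 loc_scale A r' "\<lambda>a. b * w a - \<delta>", OF P0(1) A r'(1) slack] by blast
  have "\<gamma> < measure P0 {p}"
    using P0(3) bw_sum \<alpha>(1) by (simp add: \<gamma>_def)
  then obtain U2 where U2: "openin (weak_topology loc_scale) U2" "P0 \<in> U2"
      "\<And>P. P \<in> U2 \<Longrightarrow> \<gamma> < measure P (ball p r \<inter> loc_scale)"
    using weak_neighbourhood_ball[OF P0(1) \<open>p \<in> loc_scale\<close> pr(1)] by metis
  have "log_ratio_integral f (mixture_density \<kappa> P) < ereal \<epsilon>" if "P \<in> U1 \<inter> U2" for P
  proof -
    have P: "P \<in> prob_measures loc_scale"
      using that openin_subset[OF U1(1)] by (auto simp: topspace_weak_topology)
    interpret P: prob_space P using P by (simp add: prob_measures_iff)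
    note [measurable] = mixture_density_measurable[OF P]
    have "measure P (ball p r \<inter> loc_scale) \<le> measure P K"
      by (rule P.finite_measure_mono) (auto simp: K_def intro!: borel_sets_prob_measures[OF P K_borel[unfolded K_def] pr(2)])
    then have \<gamma>K: "\<gamma> \<le> measure P K"
      using U2(3) that by force
    have deficit: "(\<integral>\<^sup>+x. ennreal (b * f x - mixture_density \<kappa> P x) \<partial>lborel) \<le> ennreal (3 * \<tau>)"
    proof -
      let ?bs = "\<lambda>x. \<Sum>a\<in>A. b * w a * kern \<kappa> a x"
      have bs: "?bs x = b * ?s x" for x
        by (simp add: sum_distrib_left mult.assoc)
      have "(\<integral>\<^sup>+x. ennreal (b * f x - mixture_density \<kappa> P x) \<partial>lborel)
          \<le> (\<integral>\<^sup>+x. ennreal \<bar>?bs x - b * f x\<bar> + ennreal (?bs x - mixture_density \<kappa> P x) \<partial>lborel)"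
      proof (rule nn_integral_mono)
        fix x
        have "ennreal (b * f x - mixture_density \<kappa> P x)
            \<le> ennreal (\<bar>?bs x - b * f x\<bar> + max 0 (?bs x - mixture_density \<kappa> P x))"
          by (intro ennreal_leI) linarith
        also have "\<dots> = ennreal \<bar>?bs x - b * f x\<bar> + ennreal (max 0 (?bs x - mixture_density \<kappa> P x))"
          by (rule ennreal_plus) auto
        also have "ennreal (max 0 (?bs x - mixture_density \<kappa> P x)) = ennreal (?bs x - mixture_density \<kappa> P x)"
          by (simp add: max_def ennreal_neg)
        finally show "ennreal (b * f x - mixture_density \<kappa> P x)
            \<le> ennreal \<bar>?bs x - b * f x\<bar> + ennreal (?bs x - mixture_density \<kappa> P x)" .
      qed
      also have "\<dots> = L1_dist ?bs (\<lambda>x. b * f x) + (\<integral>\<^sup>+x. ennreal (?bs x - mixture_density \<kappa> P x) \<partial>lborel)"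
        unfolding L1_dist_def by (rule nn_integral_add) measurable
      also have "\<dots> \<le> ennreal \<tau> + ennreal (2 * \<tau>)"
      proof (rule add_mono)
        have "L1_dist ?bs (\<lambda>x. b * f x) = ennreal b * L1_dist ?s f"
          unfolding bs using b(1) by (intro L1_dist_scale) measurable
        also have "\<dots> \<le> 1 * ennreal \<tau>"
          using s b by (intro mult_mono) auto
        finally show "L1_dist ?bs (\<lambda>x. b * f x) \<le> ennreal \<tau>" by simp
        show "(\<integral>\<^sup>+x. ennreal (?bs x - mixture_density \<kappa> P x) \<partial>lborel) \<le> ennreal (2 * \<tau>)"
        proof (rule nn_integral_mixture_deficit_le[OF P A _ less_imp_le[OF \<delta>(1)] \<delta>(2) r'(3)])
          show "b * w a \<le> measure P (ball a (r' a) \<inter> loc_scale) + \<delta>" if "a \<in> A" for a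
            using U1(3)[OF _ that, of P] \<open>P \<in> U1 \<inter> U2\<close> by force
          show "L1_dist (kern \<kappa> q) (kern \<kappa> a) \<le> ennreal \<tau>" if "a \<in> A" "q \<in> ball a (r' a)" for a q
            using r0(2)[OF that(1), of q] r'(2)[OF that(1)] that(2) by (simp add: dist_commute)
        qed
      qed
      also have "\<dots> = ennreal (3 * \<tau>)"
        using \<tau>(1) by (simp flip: ennreal_plus)
      finally show ?thesis .
    qed
    have t1: "ennreal (- ln b) * (\<integral>\<^sup>+x. ennreal (f x) \<partial>lborel) \<le> ennreal (\<epsilon> / 4)"
      unfolding b(3) f1 by simp
    have t2: "ennreal (M / (c * \<gamma>)) * (\<integral>\<^sup>+x. ennreal (b * f x - mixture_density \<kappa> P x) \<partial>lborel) \<le> ennreal (\<epsilon> / 8)"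
    proof -
      have "ennreal (M / (c * \<gamma>)) * (\<integral>\<^sup>+x. ennreal (b * f x - mixture_density \<kappa> P x) \<partial>lborel)
          \<le> ennreal (M / (c * \<gamma>)) * ennreal (3 * \<tau>)"
        by (intro mult_left_mono deficit) simp
      also have "\<dots> = ennreal (M / (c * \<gamma>) * (3 * \<tau>))"
        using \<tau>(1) by (intro ennreal_mult''[symmetric]) simp
      also have "\<dots> \<le> ennreal (\<epsilon> / 8)"
        using \<tau>(3) by (rule ennreal_leI)
      finally show ?thesis .
    qed
    have t3: "?tail (\<lambda>x. f x * ln (f x)) R \<le> ennreal (\<epsilon> / 8)"
      by (rule R1) (simp add: R_def)
    have t4: "ennreal \<bar>ln \<gamma>\<bar> * ?tail f R \<le> ennreal (\<epsilon> / 8)"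
    proof -
      have "ennreal \<bar>ln \<gamma>\<bar> * ?tail f R \<le> ennreal \<bar>ln \<gamma>\<bar> * ennreal (\<epsilon> / (8 * (\<bar>ln \<gamma>\<bar> + 1)))"
        by (intro mult_left_mono R2) (auto simp: R_def)
      also have "\<dots> = ennreal (\<bar>ln \<gamma>\<bar> * (\<epsilon> / (8 * (\<bar>ln \<gamma>\<bar> + 1))))"
        by (rule ennreal_mult'[symmetric]) simp
      also have "\<dots> \<le> ennreal (\<epsilon> / 8)"
        using \<open>0 < \<epsilon>\<close> by (intro ennreal_leI) (simp add: field_simps add_pos_nonneg)
      finally show ?thesis .
    qed
    have t5: "ennreal (1 / \<gamma>) * (\<integral>\<^sup>+q. log_tail f R q * indicator K q \<partial>P) \<le> ennreal (\<epsilon> / 8)"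
    proof -
      have "(\<integral>\<^sup>+q. log_tail f R q * indicator K q \<partial>P) \<le> (\<integral>\<^sup>+q. ennreal (\<gamma> * \<epsilon> / 8) \<partial>P)"
      proof (rule nn_integral_mono)
        fix q
        have "log_tail f R q \<le> ennreal (\<gamma> * \<epsilon> / 8)" if "q \<in> K"
          using pr(3)[of q] log_tail_antimono[of R0 R f q] that by (auto simp: K_def R_def)
        then show "log_tail f R q * indicator K q \<le> ennreal (\<gamma> * \<epsilon> / 8)"
          by (cases "q \<in> K") auto
      qed
      also have "\<dots> = ennreal (\<gamma> * \<epsilon> / 8)"
        by (simp add: P.emeasure_space_1)
      finally have "ennreal (1 / \<gamma>) * (\<integral>\<^sup>+q. log_tail f R q * indicator K q \<partial>P) \<le> ennreal (1 / \<gamma>) * ennreal (\<gamma> * \<epsilon> / 8)"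
        by (rule mult_left_mono) simp
      also have "\<dots> = ennreal (1 / \<gamma> * (\<gamma> * \<epsilon> / 8))"
        using \<gamma> by (intro ennreal_mult'[symmetric]) simp
      also have "1 / \<gamma> * (\<gamma> * \<epsilon> / 8) = \<epsilon> / 8"
        using \<gamma> by simp
      finally show ?thesis .
    qed
    note log_ratio_integral_mixture_le[OF P f_meas f K(1,2) \<gamma> \<gamma>K c b(1) less_imp_le[OF b(2)]]
    also have "enn2ereal (
      ennreal (- ln b) * (\<integral>\<^sup>+x. ennreal (f x) \<partial>lborel)
    + ennreal (M / (c * \<gamma>)) * (\<integral>\<^sup>+x. ennreal (b * f x - mixture_density \<kappa> P x) \<partial>lborel)
    + ?tail (\<lambda>x. f x * ln (f x)) R
    + ennreal \<bar>ln \<gamma>\<bar> * ?tail f R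
    + ennreal (1 / \<gamma>) * (\<integral>\<^sup>+q. log_tail f R q * indicator K q \<partial>P))
      \<le> enn2ereal (ennreal (\<epsilon> / 4) + ennreal (\<epsilon> / 8) + ennreal (\<epsilon> / 8) + ennreal (\<epsilon> / 8) + ennreal (\<epsilon> / 8))"
      unfolding less_eq_ennreal.rep_eq[symmetric] by (intro add_mono t1 t2 t3 t4 t5)
    also have "ennreal (\<epsilon> / 4) + ennreal (\<epsilon> / 8) + ennreal (\<epsilon> / 8) + ennreal (\<epsilon> / 8) + ennreal (\<epsilon> / 8) = ennreal (3 * \<epsilon> / 4)"
      using \<open>0 < \<epsilon>\<close> by (simp flip: ennreal_plus)
    also have "enn2ereal (ennreal (3 * \<epsilon> / 4)) < ereal \<epsilon>"
      using \<open>0 < \<epsilon>\<close> by (simp add: enn2ereal_ennreal)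
    finally show ?thesis .
  qed
  then show ?thesis
    using openin_Int[OF U1(1) U2(1)] U1(2) U2(2) by blast
qed

end

theorem theorem2:
  fixes \<kappa> f0 :: "real ^ 'n::finite \<Rightarrow> real"
    and Q :: "((real ^ 'n) \<times> real) measure measure"
  assumes chi: "\<kappa> \<in> prob_densities"
    and f0: "f0 \<in> prob_densities"
    and prior: "Q \<in> priors loc_scale"
    and B1: "bounded (range \<kappa>)" "continuous_on UNIV \<kappa>" "\<And>x. 0 < \<kappa> x"
    and B2: "\<exists>l1>0. \<forall>x s. l1 \<le> norm x \<and> 1 \<le> s \<longrightarrow> \<kappa> (s *\<^sub>R x) \<le> \<kappa> x"
    and B3: "\<exists>l2>0. \<forall>z. l2 \<le> norm z \<longrightarrow>
               has_partials \<kappa> z \<and> (\<Sum>i\<in>UNIV. z $ i * (partial_deriv i \<kappa> z / \<kappa> z)) < -1"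
    and B4: "\<exists>M>0. \<forall>x. 0 < f0 x \<and> f0 x \<le> M"
    and B5: "integrable lborel (\<lambda>x. f0 x * ln (f0 x))"
    and B6: "\<exists>\<delta>>0. log_ratio_integral f0 (local_inf f0 \<delta>) < \<infinity>"
    and B7a: "\<exists>\<eta>>0. integrable lborel (\<lambda>x. f0 x * ln (\<kappa> ((2 * norm x powr \<eta>) *\<^sub>R x)))"
    and B7b: "\<And>a b. 0 < b \<Longrightarrow> integrable lborel (\<lambda>x. f0 x * \<bar>ln (\<kappa> ((x - a) /\<^sub>R b))\<bar>)"
    and B8: "weak_support loc_scale Q = prob_measures loc_scale"
    and B9: "2 \<le> CARD('n) \<Longrightarrow> \<kappa> \<in> o[at_infinity](\<lambda>y. 1 / norm y ^ CARD('n))"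
  shows "f0 \<in> KL_support (induced_prior \<kappa> Q)"
proof -
  interpret positive_kernel \<kappa>
    using chi B1(2,3) by unfold_locales
  obtain M where M: "\<And>x. 0 < f0 x" "\<And>x. f0 x \<le> M"
    using B4 by blast
  have f0_meas: "f0 \<in> borel_measurable borel" and f0_mass: "(\<integral>\<^sup>+x. ennreal (f0 x) \<partial>lborel) = 1"
    using f0 by (auto simp: prob_densities_def)
  show ?thesis
  proof (rule KL_support_induced_priorI[OF prior f0_meas])
    fix \<epsilon> :: real assume "0 < \<epsilon>"
    then obtain U P0 where U: "openin (weak_topology loc_scale) U" "P0 \<in> U"
        "\<forall>P\<in>U. log_ratio_integral f0 (mixture_density \<kappa> P) < ereal \<epsilon>"
      using small_log_ratio_weak_neighbourhood[OF f0_meas M f0_mass B5 B7b] by blast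
    have sub: "U \<subseteq> prob_measures loc_scale"
      using openin_subset[OF U(1)] by (simp add: topspace_weak_topology)
    then have "P0 \<in> weak_support loc_scale Q"
      using U(2) B8 by blast
    then have "0 < emeasure Q U"
      using U(1,2) by (simp add: weak_support_def)
    then show "\<exists>U. 0 < emeasure Q U \<and>
        (\<forall>P\<in>U. P \<in> prob_measures loc_scale \<and> log_ratio_integral f0 (mixture_density \<kappa> P) < ereal \<epsilon>)"
      using U(3) sub by blast
  qed
qed

end
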